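(* Let $f$ be a linear Anosov diffeomorphism of $\mathbb T^n$. Then every $g\in\mathcal Z^2(f)$ is volume preserving and $$h_{\mathrm{top}}(g)\ge\int\sum_i\lambda_i(g,x)^+\,d\mathrm{Leb}(x),$$ where $\sum_i\lambda_i(g,\cdot)^+$ denotes the sum of the positive Lyapunov exponents of $g$ with respect to Lebesgue. In particular, if $g\in\mathcal Z^2(f)$ is partially hyperbolic, then $h_{\mathrm{top}}(g)>0$.
   Context: $\mathbb T^n=\mathbb R^n/\mathbb Z^n$, and a linear Anosov diffeomorphism is the one induced by a matrix $A\in GL(n,\mathbb Z)$, $|\det A|=1$, with no eigenvalue of modulus $1$. $\mathcal Z^2(f)$ is the group of $C^2$ diffeomorphisms $g$ of $\mathbb T^n$ with $g\circ f=f\circ g$. Volume preserving means preserving Lebesgue measure $\mathrm{Leb}$ (normalized). Lyapunov exponents $\lambda_i(g,x)$ are defined for Leb-almost every $x$ and counted with multiplicity; $t^+=\max\{t,0\}$. A $C^1$ diffeomorphism $g$ of a compact manifold $M$ is partially hyperbolic if there exist a $Dg$-invariant splitting $TM=E^u\oplus E^c$, with $E^u$ nontrivial, and constants $C>0$, $\lambda\in(0,1)$ such that $\|(Dg^n(x)|_{E^u_x})^{-1}\|\le C\lambda^n$ and $\|(Dg^n(x)|_{E^u_x})^{-1}\|\,\|Dg^n(x)|_{E^c_x}\|\le C\lambda^n$ for every $x\in M$ and $n\ge1$. *)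

theory Defs
  imports "HOL-Analysis.Analysis"
begin

section \<open>The torus\<close>

definition torus_rel :: "real ^ 'n::finite \<Rightarrow> real ^ 'n \<Rightarrow> bool" where
  "torus_rel x y \<longleftrightarrow> (\<forall>i. (x - y) $ i \<in> \<int>)"

lemma torus_rel_equivp: "equivp torus_rel"
proof (rule equivpI)
  show "reflp torus_rel" by (simp add: reflp_def torus_rel_def)
  show "symp torus_rel"
    unfolding symp_def torus_rel_def
    by (metis Ints_minus minus_diff_eq vector_uminus_component)
  show "transp torus_rel"
  proof (rule transpI)
    fix x y z :: "real ^ 'n"
    assume a: "torus_rel x y" "torus_rel y z"
    have "(x - z) $ i = (x - y) $ i + (y - z) $ i" for i by simp
    with a show "torus_rel x z"
      unfolding torus_rel_def by (metis Ints_add)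
  qed
qed

quotient_type 'n torus = "real ^ ('n::finite)" / torus_rel
  morphisms rep_torus torus_of
  by (rule torus_rel_equivp)

lemma torus_of_eq_iff: "torus_of x = torus_of y \<longleftrightarrow> torus_rel x y"
  by (simp add: torus.abs_eq_iff)

lemma torus_of_surj: "\<exists>x. torus_of x = p"
  by (metis Quotient_torus Quotient_abs_rep)

lemma torus_rel_translate:
  "torus_rel x x' \<Longrightarrow> torus_rel (y + (x - x')) y"
  by (simp add: torus_rel_def)

instantiation torus :: (finite) metric_space
begin

definition dist_torus :: "'a torus \<Rightarrow> 'a torus \<Rightarrow> real" where
  "dist_torus p q = Inf {norm (x - y) |x y. torus_of x = p \<and> torus_of y = q}"

definition uniformity_torus :: "('a torus \<times> 'a torus) filter" where
  "uniformity_torus = (INF e\<in>{0 <..}. principal {(x, y). dist x y < e})"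

definition open_torus :: "'a torus set \<Rightarrow> bool" where
  "open_torus U \<longleftrightarrow> (\<forall>x\<in>U. eventually (\<lambda>(x', y). x' = x \<longrightarrow> y \<in> U) uniformity)"

lemma torus_dist_less:
  fixes p q :: "'a torus"
  assumes "dist p q < e" and "torus_of x = p"
  obtains y where "torus_of y = q" "norm (x - y) < e"
proof -
  let ?S = "{norm (x - y) |x y. torus_of x = p \<and> torus_of y = q}"
  have ne: "?S \<noteq> {}" using torus_of_surj[of p] torus_of_surj[of q] by blast
  obtain x' y' where a: "torus_of x' = p" "torus_of y' = q" "norm (x' - y') < e"
    using cInf_lessD[OF ne assms(1)[unfolded dist_torus_def]] by blast
  have "torus_rel x x'" using assms(2) a(1) torus_of_eq_iff[of x x'] by simp
  then have "torus_of (y' + (x - x')) = q"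
    using torus_rel_translate[of x x' y'] a(2) by (simp only: torus_of_eq_iff[symmetric])
  moreover have "x - (y' + (x - x')) = x' - y'" by simp
  ultimately show thesis using that[of "y' + (x - x')"] a(3) by (simp only:)
qed

lemma torus_of_dist_le:
  fixes x y :: "real ^ 'a"
  shows "dist (torus_of x) (torus_of y) \<le> norm (x - y)"
  unfolding dist_torus_def
  by (rule cInf_lower) (auto intro!: bdd_belowI[where m = 0])

instance
proof
  show "uniformity = (INF e\<in>{0 <..}. principal {(x, y :: 'a torus). dist x y < e})"
    by (rule uniformity_torus_def)
  show "open U \<longleftrightarrow> (\<forall>x\<in>U. eventually (\<lambda>(x', y). x' = x \<longrightarrow> y \<in> U) uniformity)"
    for U :: "'a torus set"
    by (rule open_torus_def)
  show "dist p q = 0 \<longleftrightarrow> p = q" for p q :: "'a torus"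
  proof
    obtain x y where xy: "torus_of x = p" "torus_of y = q"
      using torus_of_surj by metis
    assume d: "dist p q = 0"
    have "(x - y) $ i \<in> \<int>" for i
    proof -
      have "\<exists>k\<in>\<int>. dist k ((x - y) $ i) < e" if e: "e > 0" for e
      proof -
        obtain y' where y': "torus_of y' = q" "norm (x - y') < e"
          using torus_dist_less[of p q e x] d e xy by auto
        have "(y' - y) $ i \<in> \<int>"
          using y'(1) xy(2) torus_of_eq_iff[of y' y] by (auto simp: torus_rel_def)
        moreover have "dist ((y' - y) $ i) ((x - y) $ i) = \<bar>(x - y') $ i\<bar>"
          by (simp add: dist_real_def)
        ultimately show ?thesis
          using component_le_norm_cart[of "x - y'" i] y'(2) by (metis le_less_trans)
      qed
      then have "(x - y) $ i \<in> closure \<int>" unfolding closure_approachable by blast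
      then show ?thesis by (simp only: closure_closed closed_Ints)
    qed
    then show "p = q" using xy torus_of_eq_iff[of x y] by (simp add: torus_rel_def)
  next
    assume "p = q"
    moreover obtain x where "torus_of x = p" using torus_of_surj by blast
    ultimately have "dist p q \<le> 0" using torus_of_dist_le[of x x] by simp
    moreover have "0 \<le> dist p q"
      unfolding dist_torus_def
      using torus_of_surj[of p] torus_of_surj[of q] by (intro cInf_greatest) auto
    ultimately show "dist p q = 0" by simp
  qed
  show "dist p q \<le> dist p r + dist q r" for p q r :: "'a torus"
  proof (rule field_le_epsilon)
    fix e :: real assume e: "e > 0"
    obtain z where z: "torus_of z = r" using torus_of_surj by blast
    have sym: "dist u v = dist v u" for u v :: "'a torus"
      unfolding dist_torus_def by (rule arg_cong[where f = Inf], rule Collect_cong) (metis norm_minus_commute)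
    obtain x where x: "torus_of x = p" "norm (z - x) < dist p r + e / 2"
      using torus_dist_less[of r p "dist p r + e/2" z] z e sym[of p r] by auto
    obtain y where y: "torus_of y = q" "norm (z - y) < dist q r + e / 2"
      using torus_dist_less[of r q "dist q r + e/2" z] z e sym[of q r] by auto
    have "dist p q \<le> norm (x - y)" using torus_of_dist_le[of x y] x y by simp
    also have "\<dots> \<le> norm (z - x) + norm (z - y)"
      using norm_triangle_ineq4[of "z - y" "z - x"] by simp
    finally show "dist p q \<le> dist p r + dist q r + e" using x y by linarith
  qed
qed

end

lemma continuous_on_torus_of: "continuous_on S torus_of"
proof -
  have "dist (torus_of x) (torus_of y) \<le> 1 * dist x y" for x y :: "real ^ 'n"
    using torus_of_dist_le[of x y] by (simp add: dist_norm)
  then have "1-lipschitz_on S torus_of" by (intro lipschitz_onI) auto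
  then show ?thesis by (rule lipschitz_on_continuous_on)
qed

lemma open_torus_iff: "open S \<longleftrightarrow> open (torus_of -` S)"
proof
  show "open S \<Longrightarrow> open (torus_of -` S)"
    by (rule open_vimage[OF _ continuous_on_torus_of])
next
  assume o: "open (torus_of -` S)"
  show "open S"
    unfolding open_dist
  proof
    fix p assume p: "p \<in> S"
    obtain x where x: "torus_of x = p" using torus_of_surj by blast
    then have "x \<in> torus_of -` S" using p by simp
    then obtain e where e: "e > 0" "\<And>y. dist y x < e \<Longrightarrow> torus_of y \<in> S"
      using o unfolding open_dist by auto
    have "q \<in> S" if d: "dist q p < e" for q
    proof -
      obtain y where "torus_of y = q" "norm (x - y) < e"
        using torus_dist_less[OF d[unfolded dist_commute[of q p]] x] by blast
      then show ?thesis using e(2)[of y] by (simp add: dist_norm norm_minus_commute)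
    qed
    then show "\<exists>e>0. \<forall>q. dist q p < e \<longrightarrow> q \<in> S" using e(1) by blast
  qed
qed

definition torus_leb :: "'n::finite torus measure" where
  "torus_leb =
     distr (restrict_space lborel {x. \<forall>i. 0 \<le> x $ i \<and> x $ i < 1}) borel torus_of"

lemma emeasure_space_torus_leb: "emeasure (torus_leb :: 'n::finite torus measure) (space torus_leb) = 1"
proof -
  let ?Q = "{x :: real ^ 'n. \<forall>i. 0 \<le> x $ i \<and> x $ i < 1}"
  have Q: "?Q \<in> sets lborel"
    by measurable
  have sub: "box 0 1 \<subseteq> ?Q" "?Q \<subseteq> cbox 0 1"
    by (auto simp: mem_box_cart less_imp_le)
  have "emeasure lborel (box 0 (1 :: real ^ 'n)) \<le> emeasure lborel ?Q"
    by (rule emeasure_mono[OF sub(1) Q])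
  moreover have "emeasure lborel ?Q \<le> emeasure lborel (cbox 0 (1 :: real ^ 'n))"
    by (rule emeasure_mono[OF sub(2)]) simp
  moreover have "(\<Prod>b\<in>Basis. (1 :: real ^ 'n) \<bullet> b) = 1"
    by (intro prod.neutral) (auto simp: Basis_vec_def inner_axis)
  then have "emeasure lborel (box 0 (1 :: real ^ 'n)) = 1"
      "emeasure lborel (cbox 0 (1 :: real ^ 'n)) = 1"
    by (auto simp: emeasure_lborel_box_eq emeasure_lborel_cbox_eq Basis_vec_def inner_axis)
  ultimately have "emeasure lborel ?Q = 1" by simp
  moreover have "torus_of \<in> measurable (restrict_space lborel ?Q) borel"
    by (intro measurable_restrict_space1)
      (simp add: borel_measurable_continuous_onI continuous_on_torus_of)
  ultimately show ?thesis
    using Q by (simp add: torus_leb_def emeasure_distr space_restrict_space emeasure_restrict_space)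
qed

definition preserves_measure :: "'a measure \<Rightarrow> ('a \<Rightarrow> 'a) \<Rightarrow> bool" where
  "preserves_measure M g \<longleftrightarrow> g \<in> measurable M M \<and> distr M M g = M"


section \<open>Linear Anosov diffeomorphisms\<close>

lift_definition torus_linear :: "int ^ 'n ^ 'n \<Rightarrow> 'n::finite torus \<Rightarrow> 'n torus"
  is "\<lambda>A x. map_matrix real_of_int A *v x"
proof -
  fix A :: "int ^ 'n ^ 'n" and x y :: "real ^ 'n"
  assume "torus_rel x y"
  then have "(map_matrix real_of_int A *v (x - y)) $ i \<in> \<int>" for i
    by (auto simp: torus_rel_def matrix_vector_mult_def map_matrix_def intro!: Ints_sum Ints_mult)
  then show "torus_rel (map_matrix real_of_int A *v x) (map_matrix real_of_int A *v y)"
    by (simp add: torus_rel_def matrix_vector_mult_diff_distrib)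
qed

definition complex_eigenvalue :: "int ^ 'n ^ 'n \<Rightarrow> complex \<Rightarrow> bool" where
  "complex_eigenvalue A c \<longleftrightarrow> (\<exists>v. v \<noteq> 0 \<and> map_matrix of_int A *v v = c *s v)"

definition linear_anosov :: "('n::finite torus \<Rightarrow> 'n torus) \<Rightarrow> bool" where
  "linear_anosov f \<longleftrightarrow>
     (\<exists>A. \<bar>det A\<bar> = 1 \<and> (\<forall>c. complex_eigenvalue A c \<longrightarrow> cmod c \<noteq> 1) \<and> f = torus_linear A)"


section \<open>Smooth maps of the torus\<close>

definition C1_on :: "'a::real_normed_vector set \<Rightarrow> ('a \<Rightarrow> 'b::real_normed_vector) \<Rightarrow> bool" where
  "C1_on U G \<longleftrightarrow>
     (\<exists>G'. (\<forall>x\<in>U. (G has_derivative blinfun_apply (G' x)) (at x)) \<and> continuous_on U G')"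

definition C2_on :: "'a::real_normed_vector set \<Rightarrow> ('a \<Rightarrow> 'b::real_normed_vector) \<Rightarrow> bool" where
  "C2_on U G \<longleftrightarrow>
     (\<exists>G'. (\<forall>x\<in>U. (G has_derivative blinfun_apply (G' x)) (at x)) \<and> C1_on U G')"

text \<open>The charts of the torus are the local inverses of the projection from Euclidean space. A map
  of the torus is smooth when it is so in these charts, that is, when it has smooth local lifts.\<close>

definition torus_C1 :: "('n::finite torus \<Rightarrow> 'n torus) \<Rightarrow> bool" where
  "torus_C1 g \<longleftrightarrow>
     (\<forall>x. \<exists>U G. open U \<and> x \<in> U \<and> C1_on U G \<and> (\<forall>y\<in>U. torus_of (G y) = g (torus_of y)))"

definition torus_C2 :: "('n::finite torus \<Rightarrow> 'n torus) \<Rightarrow> bool" where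
  "torus_C2 g \<longleftrightarrow>
     (\<forall>x. \<exists>U G. open U \<and> x \<in> U \<and> C2_on U G \<and> (\<forall>y\<in>U. torus_of (G y) = g (torus_of y)))"

definition C1_diffeo :: "('n::finite torus \<Rightarrow> 'n torus) \<Rightarrow> bool" where
  "C1_diffeo g \<longleftrightarrow> bij g \<and> torus_C1 g \<and> torus_C1 (inv g)"

definition C2_diffeo :: "('n::finite torus \<Rightarrow> 'n torus) \<Rightarrow> bool" where
  "C2_diffeo g \<longleftrightarrow> bij g \<and> torus_C2 g \<and> torus_C2 (inv g)"

definition C2_centralizer :: "('n::finite torus \<Rightarrow> 'n torus) \<Rightarrow> ('n torus \<Rightarrow> 'n torus) set" where
  "C2_centralizer f = {g. C2_diffeo g \<and> g \<circ> f = f \<circ> g}"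

text \<open>All tangent spaces of the torus are identified with Euclidean space through the differential
  of the projection.\<close>

definition has_torus_derivative ::
  "('n::finite torus \<Rightarrow> 'n torus) \<Rightarrow> (real ^ 'n \<Rightarrow> real ^ 'n) \<Rightarrow> 'n torus \<Rightarrow> bool" where
  "has_torus_derivative g D p \<longleftrightarrow>
     (\<exists>x G. torus_of x = p \<and> (\<forall>\<^sub>F y in nhds x. torus_of (G y) = g (torus_of y)) \<and>
            (G has_derivative D) (at x))"

definition torus_deriv ::
  "('n::finite torus \<Rightarrow> 'n torus) \<Rightarrow> 'n torus \<Rightarrow> real ^ 'n \<Rightarrow> real ^ 'n" where
  "torus_deriv g p = (THE D. has_torus_derivative g D p)"

lemma has_torus_derivative_unique:
  assumes "has_torus_derivative g D p" and "has_torus_derivative g E p"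
  shows "D = E"
proof -
  obtain x G where G: "torus_of x = p" "\<forall>\<^sub>F y in nhds x. torus_of (G y) = g (torus_of y)"
      "(G has_derivative D) (at x)"
    using assms(1) unfolding has_torus_derivative_def by blast
  obtain x' H where H: "torus_of x' = p" "\<forall>\<^sub>F y in nhds x'. torus_of (H y) = g (torus_of y)"
      "(H has_derivative E) (at x')"
    using assms(2) unfolding has_torus_derivative_def by blast
  define K where "K = (\<lambda>y. H (y + (x' - x)))"
  have K_deriv: "(K has_derivative E) (at x)"
  proof -
    have "((\<lambda>y. y + (x' - x)) has_derivative (\<lambda>h. h)) (at x)"
      by (auto intro!: derivative_eq_intros)
    from has_derivative_compose[OF this, of H E] H(3) show ?thesis
      by (simp add: K_def)
  qed
  have rel: "torus_rel x' x" using G(1) H(1) torus_of_eq_iff[of x' x] by simp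
  have shift: "torus_of (y + (x' - x)) = torus_of y" for y
    using torus_rel_translate[OF rel] by (simp only: torus_of_eq_iff)
  have "filterlim (\<lambda>y. y + (x' - x)) (nhds x') (nhds x)"
  proof -
    have "((\<lambda>y. y + (x' - x)) \<longlongrightarrow> x + (x' - x)) (nhds x)"
      by (intro tendsto_intros filterlim_ident)
    then show ?thesis by simp
  qed
  from eventually_compose_filterlim[OF H(2) this]
  have "\<forall>\<^sub>F y in nhds x. torus_of (K y) = g (torus_of y)"
    by (simp only: K_def shift)
  with G(2) have int: "\<forall>\<^sub>F y in nhds x. torus_rel (K y) (G y)"
    by eventually_elim (simp only: torus_of_eq_iff[symmetric])
  define \<delta> where "\<delta> = (\<lambda>y. K y - G y)"
  have d_deriv: "(\<delta> has_derivative (\<lambda>h. E h - D h)) (at x)"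
    unfolding \<delta>_def by (intro derivative_intros K_deriv G(3))
  then have "isCont \<delta> x" by (rule has_derivative_continuous)
  then have "\<forall>\<^sub>F y in at x. dist (\<delta> y) (\<delta> x) < 1"
    unfolding isCont_def by (rule tendstoD) simp
  then have near: "\<forall>\<^sub>F y in nhds x. dist (\<delta> y) (\<delta> x) < 1"
    by (simp add: eventually_nhds_conv_at)
  have int_x: "\<delta> x $ i \<in> \<int>" for i
    using eventually_nhds_x_imp_x[OF int] by (simp add: torus_rel_def \<delta>_def)
  have "\<forall>\<^sub>F y in nhds x. \<delta> y = \<delta> x"
    using int near
  proof eventually_elim
    case (elim y)
    have "\<delta> y $ i - \<delta> x $ i = 0" for i
    proof (rule Ints_nonzero_abs_less1)
      show "\<delta> y $ i - \<delta> x $ i \<in> \<int>"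
        using elim(1) int_x by (auto simp: torus_rel_def \<delta>_def)
      show "\<bar>\<delta> y $ i - \<delta> x $ i\<bar> < 1"
        using component_le_norm_cart[of "\<delta> y - \<delta> x" i] elim(2) by (simp add: dist_norm)
    qed
    then show ?case by (simp add: vec_eq_iff)
  qed
  then have "((\<lambda>_. \<delta> x) has_derivative (\<lambda>h. E h - D h)) (at x)"
    using has_derivative_transform_eventually[OF d_deriv, of "\<lambda>_. \<delta> x"]
    by (simp add: eventually_nhds_conv_at)
  then have "(\<lambda>h. E h - D h) = (\<lambda>h. 0)"
    using has_derivative_unique has_derivative_const by blast
  then show "D = E" by (simp add: fun_eq_iff)
qed


section \<open>Topological entropy\<close>

text \<open>Bowen's definition for a self-map of a compact metric space, by separated sets.\<close>

definition separated :: "('a::metric_space \<Rightarrow> 'a) \<Rightarrow> nat \<Rightarrow> real \<Rightarrow> 'a set \<Rightarrow> bool" where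
  "separated g n \<epsilon> S \<longleftrightarrow>
     (\<forall>x\<in>S. \<forall>y\<in>S. x \<noteq> y \<longrightarrow> (\<exists>k<n. dist ((g ^^ k) x) ((g ^^ k) y) > \<epsilon>))"

definition topological_entropy :: "('a::metric_space \<Rightarrow> 'a) \<Rightarrow> ereal" where
  "topological_entropy g =
     (SUP \<epsilon>\<in>{0<..}. limsup (\<lambda>n.
        SUP S\<in>{S. finite S \<and> S \<noteq> {} \<and> separated g n \<epsilon> S}. ereal (ln (real (card S)) / real n)))"


section \<open>Lyapunov exponents\<close>

text \<open>At a point that is regular in the sense of Oseledets' theorem, \<open>oseledets_space g p l\<close> is the
  summand of the Oseledets splitting that belongs to the exponent \<open>l\<close>, and is zero if \<open>l\<close> is not an
  exponent at \<open>p\<close>.\<close>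

definition oseledets_space ::
  "('n::finite torus \<Rightarrow> 'n torus) \<Rightarrow> 'n torus \<Rightarrow> real \<Rightarrow> (real ^ 'n) set" where
  "oseledets_space g p l = {v. v = 0 \<or>
     (\<lambda>n. ln (norm (torus_deriv (g ^^ n) p v)) / real n) \<longlonglongrightarrow> l \<and>
     (\<lambda>n. ln (norm (torus_deriv (inv g ^^ n) p v)) / real n) \<longlonglongrightarrow> - l}"

definition lyapunov_exponents :: "('n::finite torus \<Rightarrow> 'n torus) \<Rightarrow> 'n torus \<Rightarrow> real set" where
  "lyapunov_exponents g p = {l. oseledets_space g p l \<noteq> {0}}"

text \<open>Vectors with distinct forward exponents are linearly independent, so the sum is always
  finite; the multiplicity of an exponent is the dimension of its Oseledets space.\<close>

definition sum_pos_lyapunov :: "('n::finite torus \<Rightarrow> 'n torus) \<Rightarrow> 'n torus \<Rightarrow> real" where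
  "sum_pos_lyapunov g p =
     (\<Sum>l\<in>lyapunov_exponents g p. real (dim (oseledets_space g p l)) * max l 0)"


section \<open>Partial hyperbolicity\<close>

text \<open>The quotient is \<open>0\<close> at \<open>v = 0\<close>, as in \<open>onorm\<close>, so the norm on the zero subspace is \<open>0\<close>.\<close>

definition onorm_on ::
  "'a::real_normed_vector set \<Rightarrow> ('a \<Rightarrow> 'b::real_normed_vector) \<Rightarrow> real" where
  "onorm_on S L = (SUP v\<in>S. norm (L v) / norm v)"

definition partially_hyperbolic :: "('n::finite torus \<Rightarrow> 'n torus) \<Rightarrow> bool" where
  "partially_hyperbolic g \<longleftrightarrow> C1_diffeo g \<and>
     (\<exists>(Eu :: 'n torus \<Rightarrow> (real ^ 'n) set) (Ec :: 'n torus \<Rightarrow> (real ^ 'n) set).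
        (\<forall>p. subspace (Eu p) \<and> subspace (Ec p) \<and>
             Eu p \<inter> Ec p = {0} \<and> {u + v |u v. u \<in> Eu p \<and> v \<in> Ec p} = UNIV \<and>
             torus_deriv g p ` Eu p = Eu (g p) \<and> torus_deriv g p ` Ec p = Ec (g p) \<and>
             Eu p \<noteq> {0}) \<and>
        (\<exists>C>0. \<exists>\<rho>. 0 < \<rho> \<and> \<rho> < 1 \<and>
           (\<forall>p. \<forall>n\<ge>1.
              (let Dn = torus_deriv (g ^^ n) p;
                   inv_norm = onorm_on (Eu ((g ^^ n) p)) (inv_into (Eu p) Dn)
               in inv_norm \<le> C * \<rho> ^ n \<and> inv_norm * onorm_on (Ec p) Dn \<le> C * \<rho> ^ n))))"

end

theory Submission
  imports Defs "HOL-Computational_Algebra.Fundamental_Theorem_Algebra"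
begin

text \<open>The theorem rests on a rigidity phenomenon found by Adler and Palais: a homeomorphism \<open>g\<close> of
  the torus that commutes with a linear Anosov diffeomorphism is affine. Lift \<open>g\<close> to a continuous map
  \<open>G\<close> of Euclidean space. It is equivariant under integer translations up to a matrix \<open>B\<close>, so that
  \<open>G x = B x + \<phi> x\<close> with \<open>\<phi>\<close> periodic, hence bounded. If \<open>A\<close> is the matrix of the Anosov
  diffeomorphism, then \<open>G (A x) - A (G x)\<close> is continuous and has integer entries, so it is constant.
  As \<open>\<phi>\<close> is bounded, this forces \<open>A\<close> and \<open>B\<close> to commute, and after subtraction of a constant
  \<open>\<phi>\<close> carries \<open>A\<close>-orbits to bounded two-sided \<open>A\<close>-orbits. A hyperbolic matrix has only the
  trivial one (\<open>hyperbolic_bounded_orbit_zero\<close>), so \<open>\<phi>\<close> is constant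
  (\<open>commuting_with_anosov_is_affine\<close>). The same applies to the inverse of \<open>g\<close>, so \<open>B\<close> is invertible.

  Thus \<open>g\<close> is the affine map induced by \<open>x \<mapsto> B x + c\<close>, its derivative is \<open>B\<close> everywhere, and
  the three claims become statements on \<open>B\<close>.

  Preservation of volume is the uniqueness of Haar measure: the image of Lebesgue measure under an
  affine bijection is again invariant under translations, and two translation invariant probability
  measures agree by Fubini's theorem (\<open>torus_leb_vimage_affine\<close>).

  For the entropy, \<open>entropy_ge_sum_expansion_rates\<close> counts the points of a grid: if the coefficient of
  a vector along \<open>v b\<close> is bounded, up to a constant factor, by \<open>exp (- n * r b)\<close> times the length of
  its image under \<open>B ^^ n\<close>, then a grid with mesh of order \<open>exp (- n * r b)\<close> in the direction of
  \<open>v b\<close> consists of separated points, and the number of its points grows like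
  \<open>exp (n * (\<Sum>b. r b))\<close>. Lyapunov exponents provide such coefficients, as follows. The vectors that
  grow forwards at rate at most \<open>l\<close> and backwards at rate at most \<open>- l\<close> form an invariant subspace
  \<open>lyapunov_space\<close>, and the subspaces of different \<open>l\<close> are independent. On such a subspace the
  backward bound says that \<open>B ^^ n\<close> expands every vector by nearly \<open>exp (n * l)\<close>, which is the
  hypothesis of the counting lemma for a basis that is adapted to these subspaces. The Oseledets space
  of \<open>l\<close> is contained in \<open>lyapunov_space\<close>, so the dimensions count at least the multiplicities.

  If \<open>g\<close> is partially hyperbolic, a single vector of the unstable subspace at one point is
  expanded exponentially, and the counting lemma applied to the line that it spans gives positive
  entropy.\<close>

section \<open>Bounded orbits of hyperbolic matrices\<close>

text \<open>The vector \<open>p(T) w\<close>.\<close>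

definition poly_apply :: "(complex ^ 'n \<Rightarrow> complex ^ 'n) \<Rightarrow> complex poly \<Rightarrow> complex ^ 'n \<Rightarrow> complex ^ 'n"
  where "poly_apply T p w = (\<Sum>i\<le>degree p. coeff p i *s (T ^^ i) w)"

lemma poly_apply_eq_sum:
  assumes "degree p \<le> n"
  shows "poly_apply T p w = (\<Sum>i\<le>n. coeff p i *s (T ^^ i) w)"
  unfolding poly_apply_def
  by (rule sum.mono_neutral_left) (use assms in \<open>auto simp: coeff_eq_0\<close>)

text \<open>This makes \<open>q(T) w\<close> an eigenvector as soon as \<open>(X - c) q\<close> annihilates \<open>w\<close>.\<close>

lemma poly_apply_linear_factor:
  assumes add: "\<And>x y. T (x + y) = T x + T y" and scale: "\<And>c x. T (c *s x) = c *s T x"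
  shows "poly_apply T ([:-c, 1:] * q) w = T (poly_apply T q w) - c *s poly_apply T q w"
proof -
  have T0: "T 0 = 0" using scale[of 0 0] by simp
  have T_sum: "T (\<Sum>i\<in>I. h i) = (\<Sum>i\<in>I. T (h i))" for I :: "nat set" and h
    by (induction I rule: infinite_finite_induct) (auto simp: T0 add)
  have p: "[:-c, 1:] * q = pCons 0 q - smult c q" by simp
  define n where "n = degree q"
  have "degree ([:-c, 1:] * q) \<le> Suc n"
    unfolding n_def by (rule order.trans[OF degree_mult_le]) simp
  then have "poly_apply T ([:-c, 1:] * q) w
      = (\<Sum>i\<le>Suc n. (coeff (pCons 0 q) i - c * coeff q i) *s (T ^^ i) w)"
    unfolding p by (subst poly_apply_eq_sum[of _ "Suc n"]) auto
  also have "\<dots> = (\<Sum>i\<le>Suc n. coeff (pCons 0 q) i *s (T ^^ i) w)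
      - c *s (\<Sum>i\<le>Suc n. coeff q i *s (T ^^ i) w)"
    by (simp only: vec.scale_left_diff_distrib sum_subtractf vec.scale_sum_right vec.scale_scale)
  also have "(\<Sum>i\<le>Suc n. coeff (pCons 0 q) i *s (T ^^ i) w)
      = (\<Sum>i\<le>n. coeff q i *s T ((T ^^ i) w))"
    by (subst sum.atMost_Suc_shift) simp
  also have "\<dots> = T (poly_apply T q w)"
    by (simp add: poly_apply_def n_def T_sum scale)
  also have "(\<Sum>i\<le>Suc n. coeff q i *s (T ^^ i) w) = poly_apply T q w"
    by (rule poly_apply_eq_sum[symmetric]) (simp add: n_def)
  finally show ?thesis .
qed

text \<open>The vectors \<open>w, T w, T\<^sup>2 w, \<dots>\<close> lie in a space of finite real dimension, so they are linearly
  dependent, already with real coefficients.\<close>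

lemma ex_annihilating_poly:
  fixes w :: "complex ^ 'n::finite"
  shows "\<exists>p. p \<noteq> 0 \<and> poly_apply T p w = 0"
proof -
  define N where "N = DIM(complex ^ 'n)"
  define h where "h i = (T ^^ i) w" for i
  show ?thesis
  proof (cases "inj_on h {..N}")
    case True
    then have "card (h ` {..N}) = Suc N" by (simp add: card_image)
    then have "dependent (h ` {..N})"
      by (intro dependent_biggerset) (simp add: N_def)
    then obtain u v where u: "v \<in> h ` {..N}" "u v \<noteq> 0" "(\<Sum>v\<in>h ` {..N}. u v *\<^sub>R v) = 0"
      by (auto simp: dependent_finite)
    obtain k where k: "k \<le> N" "v = h k" using u(1) by auto
    define p where "p = (\<Sum>i\<le>N. monom (complex_of_real (u (h i))) i)"
    have coeff: "coeff p i = (if i \<le> N then complex_of_real (u (h i)) else 0)" for i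
      by (simp add: p_def coeff_sum)
    have deg: "degree p \<le> N" by (rule degree_le) (simp add: coeff)
    have "p \<noteq> 0" using coeff[of k] k u(2) by auto
    moreover have "complex_of_real r *s x = r *\<^sub>R x" for r and x :: "complex ^ 'n"
      unfolding vec_eq_iff vector_smult_component vector_scaleR_component by (simp add: scaleR_conv_of_real)
    then have "poly_apply T p w = (\<Sum>i\<le>N. u (h i) *\<^sub>R h i)"
      unfolding poly_apply_eq_sum[OF deg] by (intro sum.cong) (auto simp: coeff h_def)
    then have "poly_apply T p w = 0"
      using u(3) True by (simp add: sum.reindex)
    ultimately show ?thesis by blast
  next
    case False
    then obtain i j where ij: "i \<noteq> j" "h i = h j" by (auto simp: inj_on_def)
    define p where "p = monom 1 i - monom (1::complex) j"
    have coeff: "coeff p k = (if k = i then 1 else 0) - (if k = j then 1 else 0)" for k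
      by (auto simp add: p_def)
    have "coeff p i \<noteq> 0" using ij(1) by (simp add: coeff)
    then have "p \<noteq> 0" by auto
    have deg: "degree p \<le> max i j" by (rule degree_le) (simp add: coeff)
    have "poly_apply T p w = (\<Sum>k\<le>max i j. (if k = i then h k else 0) - (if k = j then h k else 0))"
      unfolding poly_apply_eq_sum[OF deg] by (intro sum.cong) (auto simp: coeff h_def)
    also have "\<dots> = 0" using ij(2) by (simp add: sum_subtractf)
    finally show ?thesis using \<open>p \<noteq> 0\<close> by blast
  qed
qed

text \<open>Split off a root from an annihilating polynomial of minimal degree: the cofactor does not annihilate
  \<open>w\<close>. The eigenvector is produced in the form \<open>q(T) w\<close>, so that it inherits every property of \<open>w\<close> that
  defines an invariant subspace.\<close>

lemma ex_eigenvector_poly_apply: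
  fixes T :: "complex ^ 'n::finite \<Rightarrow> complex ^ 'n"
  assumes add: "\<And>x y. T (x + y) = T x + T y" and scale: "\<And>c x. T (c *s x) = c *s T x"
    and "w \<noteq> 0"
  obtains q c where "poly_apply T q w \<noteq> 0" "T (poly_apply T q w) = c *s poly_apply T q w"
proof -
  define P where "P p \<longleftrightarrow> p \<noteq> 0 \<and> poly_apply T p w = 0" for p
  obtain p where p: "P p" "\<And>q. P q \<Longrightarrow> degree p \<le> degree q"
    using ex_annihilating_poly[of T w] ex_has_least_nat[of P _ degree] unfolding P_def by metis
  have "degree p \<noteq> 0"
  proof
    assume d: "degree p = 0"
    then have "coeff p 0 *s w = 0" using p(1) by (simp add: P_def poly_apply_def)
    then show False
      using \<open>w \<noteq> 0\<close> p(1) leading_coeff_0_iff[of p] d by (simp add: P_def)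
  qed
  then obtain c where "poly p c = 0"
    using fundamental_theorem_of_algebra_alt[of p] by force
  then obtain q where q: "p = [:-c, 1:] * q" by (auto simp: poly_eq_0_iff_dvd dvd_def)
  have "q \<noteq> 0" using p(1) q by (auto simp: P_def)
  then have "degree p = Suc (degree q)"
    unfolding q by (subst degree_mult_eq) auto
  then have "poly_apply T q w \<noteq> 0" using p(2)[of q] \<open>q \<noteq> 0\<close> by (auto simp: P_def)
  moreover have "T (poly_apply T q w) - c *s poly_apply T q w = 0"
    using p(1) unfolding q P_def by (simp only: poly_apply_linear_factor[OF add scale])
  ultimately show thesis using that by simp
qed

lemma norm_smult_complex: "norm (c *s x) = cmod c * norm x" for x :: "complex ^ 'n::finite"
  by (simp add: norm_vec_def norm_mult L2_set_right_distrib)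

lemma powers_le_imp_le_1:
  fixes a K :: real
  assumes "\<And>n::nat. a ^ n \<le> K"
  shows "a \<le> 1"
proof (rule ccontr)
  assume "\<not> a \<le> 1"
  then obtain n where "K < a ^ n" using real_arch_pow[of a K] by auto
  then show False using assms[of n] by simp
qed

text \<open>The vectors whose two-sided orbit is bounded form an invariant subspace. If it is nontrivial, it contains
  an eigenvector, and boundedness of \<open>c ^ n\<close> and of its inverse forces the modulus of the eigenvalue
  to be one.\<close>

lemma bounded_orbit_unit_eigenvalue:
  fixes T T' :: "complex ^ 'n::finite \<Rightarrow> complex ^ 'n"
  assumes add: "\<And>x y. T (x + y) = T x + T y" and scale: "\<And>c x. T (c *s x) = c *s T x"
    and T': "\<And>x. T' (T x) = x" "\<And>x. T (T' x) = x"
    and w: "w \<noteq> 0" "bounded (range (\<lambda>n. (T ^^ n) w))" "bounded (range (\<lambda>n. (T' ^^ n) w))"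
  obtains u c where "u \<noteq> 0" "T u = c *s u" "cmod c = 1"
proof -
  have add': "T' (x + y) = T' x + T' y" for x y by (metis T' add)
  have scale': "T' (c *s x) = c *s T' x" for c x by (metis T' scale)
  define V where "V = {x. bounded (range (\<lambda>n. (T ^^ n) x)) \<and> bounded (range (\<lambda>n. (T' ^^ n) x))}"
  have pow: "(F ^^ n) (x + y) = (F ^^ n) x + (F ^^ n) y" "(F ^^ n) (c *s x) = c *s (F ^^ n) x"
    if "\<And>x y. F (x + y) = F x + F y" "\<And>c x. F (c *s x) = c *s F x"
    for F :: "complex ^ 'n \<Rightarrow> complex ^ 'n" and n x y c
    by (induction n) (simp_all add: that)
  have V_add: "x + y \<in> V" if "x \<in> V" "y \<in> V" for x y
  proof -
    have "bounded (range (\<lambda>n. (F ^^ n) (x + y)))"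
      if F: "\<And>x y. F (x + y) = F x + F y" "\<And>c x. F (c *s x) = c *s F x"
        "bounded (range (\<lambda>n. (F ^^ n) x))" "bounded (range (\<lambda>n. (F ^^ n) y))"
      for F :: "complex ^ 'n \<Rightarrow> complex ^ 'n"
      unfolding pow(1)[of F, OF F(1,2)] by (rule bounded_plus_comp[OF F(3,4)])
    from this[of T, OF add scale] this[of T', OF add' scale'] that show ?thesis
      unfolding V_def by blast
  qed
  have V_scale: "c *s x \<in> V" if "x \<in> V" for c x
  proof -
    have "bounded (range (\<lambda>n. (F ^^ n) (c *s x)))"
      if F: "\<And>x y. F (x + y) = F x + F y" "\<And>c x. F (c *s x) = c *s F x"
        "bounded (range (\<lambda>n. (F ^^ n) x))"
      for F :: "complex ^ 'n \<Rightarrow> complex ^ 'n"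
    proof -
      obtain K where "\<And>n. norm ((F ^^ n) x) \<le> K" using F(3) by (auto simp: bounded_iff)
      then have "norm ((F ^^ n) (c *s x)) \<le> cmod c * K" for n
        unfolding pow(2)[of F, OF F(1,2)] norm_smult_complex by (simp add: mult_left_mono)
      then show ?thesis by (auto simp: bounded_iff)
    qed
    from this[of T, OF add scale] this[of T', OF add' scale'] that show ?thesis
      unfolding V_def by blast
  qed
  have V_T: "T x \<in> V" if x: "x \<in> V" for x
  proof -
    obtain K where K: "\<And>n. norm ((T ^^ n) x) \<le> K" using x by (auto simp: bounded_iff V_def)
    obtain L where L: "\<And>n. norm ((T' ^^ n) x) \<le> L" using x by (auto simp: bounded_iff V_def)
    have "norm ((T ^^ n) (T x)) \<le> K" for n
      using K[of "Suc n"] by (simp add: funpow_swap1)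
    moreover have "norm ((T' ^^ n) (T x)) \<le> L + norm (T x)" for n
    proof (cases n)
      case (Suc m)
      then have "(T' ^^ n) (T x) = (T' ^^ m) x" by (simp add: funpow_swap1 T')
      then show ?thesis using L[of m] by (simp add: add_increasing2)
    next
      case 0 then show ?thesis using order.trans[OF norm_ge_zero L[of 0]] by simp
    qed
    ultimately show ?thesis by (auto simp: V_def bounded_iff)
  qed
  have "w \<in> V" using w by (simp add: V_def)
  then have iter: "(T ^^ i) w \<in> V" for i by (induction i) (auto intro: V_T)
  have "0 \<in> V" using V_scale[OF \<open>w \<in> V\<close>, of 0] by simp
  then have V_sum: "(\<Sum>i\<in>I. coeff q i *s (T ^^ i) w) \<in> V" for q I
    by (induction I rule: infinite_finite_induct) (auto intro!: V_add V_scale iter)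
  obtain q c where q: "poly_apply T q w \<noteq> 0" "T (poly_apply T q w) = c *s poly_apply T q w"
    using ex_eigenvector_poly_apply[of T w] add scale w(1) by metis
  define u where "u = poly_apply T q w"
  have u: "u \<noteq> 0" "T u = c *s u" "u \<in> V" using q V_sum by (auto simp: u_def poly_apply_def)
  have "c \<noteq> 0"
  proof
    assume "c = 0"
    then have "u = T' 0" using u(2) T'(1)[of u] by simp
    also have "T' 0 = 0" using scale'[of 0 0] by simp
    finally show False using u(1) by simp
  qed
  have u': "T' u = inverse c *s u"
  proof -
    have "u = c *s T' u" using u(2) T'(1)[of u] scale' by simp
    then have "inverse c *s u = inverse c *s (c *s T' u)" by simp
    then show ?thesis using \<open>c \<noteq> 0\<close> by simp
  qed
  have le1: "cmod d \<le> 1"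
    if F: "\<And>c x. F (c *s x) = c *s F x" "bounded (range (\<lambda>n. (F ^^ n) u))" "F u = d *s u" for F d
  proof -
    have "(F ^^ n) u = d ^ n *s u" for n
      by (induction n) (simp_all add: F mult.commute)
    then obtain K where "\<And>n. cmod d ^ n * norm u \<le> K"
      using F(2) by (auto simp: bounded_iff norm_smult_complex norm_power)
    then have "cmod d ^ n \<le> K / norm u" for n using u(1) by (simp add: field_simps)
    then show ?thesis by (rule powers_le_imp_le_1)
  qed
  have "cmod c \<le> 1" using le1[of T c, OF scale] u by (simp add: V_def)
  moreover have "cmod (inverse c) \<le> 1" using le1[of T' "inverse c", OF scale'] u u' by (simp add: V_def)
  then have "1 \<le> cmod c" using \<open>c \<noteq> 0\<close> by (simp add: norm_divide inverse_eq_divide)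
  ultimately show thesis using that u by simp
qed

text \<open>A nonzero bounded orbit, viewed in complex space, would yield an eigenvalue of modulus one.\<close>

lemma hyperbolic_bounded_orbit_zero:
  fixes A :: "int ^ 'n::finite ^ 'n" and Q :: "real ^ 'n ^ 'n" and v :: "int \<Rightarrow> real ^ 'n"
  assumes hyp: "\<forall>c. complex_eigenvalue A c \<longrightarrow> cmod c \<noteq> 1"
    and inv: "Q ** map_matrix real_of_int A = mat 1" "map_matrix real_of_int A ** Q = mat 1"
    and step: "\<And>k. v (k + 1) = map_matrix real_of_int A *v v k"
    and bdd: "bounded (range v)"
  shows "v 0 = 0"
proof (rule ccontr)
  assume nz: "v 0 \<noteq> 0"
  define cv where "cv x = (\<chi> i. complex_of_real (x $ i))" for x :: "real ^ 'n"
  define T where "T = (\<lambda>x. map_matrix of_int A *v (x :: complex ^ 'n))"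
  define Q' where "Q' = map_matrix complex_of_real Q"
  define T' where "T' = (\<lambda>x. Q' *v (x :: complex ^ 'n))"
  have id: "mat 1 = map_matrix complex_of_real (mat 1 :: real ^ 'n ^ 'n)"
    by (simp add: vec_eq_iff mat_def map_matrix_def)
  have QA: "Q' ** map_matrix of_int A = mat 1"
    unfolding id inv(1)[symmetric]
    by (simp add: vec_eq_iff Q'_def map_matrix_def matrix_matrix_mult_def)
  have AQ: "map_matrix of_int A ** Q' = mat 1"
    unfolding id inv(2)[symmetric]
    by (simp add: vec_eq_iff Q'_def map_matrix_def matrix_matrix_mult_def)
  have T_cv: "T (cv x) = cv (map_matrix real_of_int A *v x)" for x
    by (simp add: T_def cv_def vec_eq_iff matrix_vector_mult_def map_matrix_def)
  have norm_cv: "norm (cv x) = norm x" for x by (simp add: cv_def norm_vec_def)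
  have T'T: "T' (T x) = x" "T (T' x) = x" for x
    by (simp_all add: T_def T'_def matrix_vector_mul_assoc QA AQ)
  have fwd: "(T ^^ n) (cv (v 0)) = cv (v (int n))" for n
    by (induction n) (simp_all add: T_cv step[symmetric] add.commute)
  have bwd: "(T' ^^ n) (cv (v 0)) = cv (v (- int n))" for n
  proof (induction n)
    case (Suc n)
    have "cv (v (- int n)) = T (cv (v (- int n - 1)))"
      using step[of "- int n - 1"] by (simp add: T_cv)
    then have "T' (cv (v (- int n))) = cv (v (- int n - 1))" by (simp add: T'T)
    moreover have "- int n - 1 = - int (Suc n)" by simp
    ultimately show ?case using Suc by (simp only: funpow.simps o_apply)
  qed simp
  obtain K where K: "\<And>k. norm (v k) \<le> K" using bdd by (auto simp: bounded_iff)
  have "bounded (range (\<lambda>n. (T ^^ n) (cv (v 0))))" "bounded (range (\<lambda>n. (T' ^^ n) (cv (v 0))))"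
    unfolding bounded_iff fwd bwd using K by (auto simp: norm_cv)
  moreover have "cv (v 0) \<noteq> 0" using nz norm_cv[of "v 0"] by auto
  moreover have "T (x + y) = T x + T y" "T (c *s x) = c *s T x" for x y c
    by (simp_all add: T_def vec.add matrix_vector_right_distrib vec.scale)
  ultimately obtain u c where "u \<noteq> 0" "T u = c *s u" "cmod c = 1"
    using bounded_orbit_unit_eigenvalue[of T T' "cv (v 0)"] T'T by metis
  then show False using hyp unfolding complex_eigenvalue_def T_def by blast
qed

section \<open>The integer lattice and lifts of torus maps\<close>

definition int_lattice :: "(real ^ 'n::finite) set" where
  "int_lattice = {x. \<forall>i. x $ i \<in> \<int>}"

lemma torus_of_eq_iff_lattice: "torus_of x = torus_of y \<longleftrightarrow> x - y \<in> int_lattice"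
  by (simp add: torus_of_eq_iff torus_rel_def int_lattice_def)

lemma torus_of_add_lattice [simp]: "m \<in> int_lattice \<Longrightarrow> torus_of (x + m) = torus_of x"
  by (simp add: torus_of_eq_iff_lattice)

text \<open>Continuous maps into a discrete set are constant on a connected space. This is how identities between
  torus maps become identities between their lifts.\<close>

lemma continuous_lattice_valued_constant:
  fixes H :: "real ^ 'm::finite \<Rightarrow> real ^ 'n::finite"
  assumes "continuous_on UNIV H" and int: "\<And>x. H x \<in> int_lattice"
  shows "H x = H y"
proof -
  have "H x $ i = H y $ i" for i
  proof -
    have "(\<lambda>x. H x $ i) constant_on UNIV"
    proof (rule continuous_discrete_range_constant)
      show "continuous_on UNIV (\<lambda>x. H x $ i)"
        by (intro continuous_intros assms(1))
      fix u
      have "1 \<le> norm (H v $ i - H u $ i)" if "H v $ i \<noteq> H u $ i" for v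
        using Ints_nonzero_abs_ge1[of "H v $ i - H u $ i"] int that
        by (auto simp: int_lattice_def)
      then show "\<exists>e>0. \<forall>v. v \<in> UNIV \<and> H v $ i \<noteq> H u $ i \<longrightarrow> e \<le> norm (H v $ i - H u $ i)"
        by (intro exI[of _ 1]) simp
    qed (rule connected_UNIV)
    then show ?thesis by (auto simp: constant_on_def)
  qed
  then show ?thesis by (simp add: vec_eq_iff)
qed

lemma continuous_on_torusI:
  fixes F :: "'n::finite torus \<Rightarrow> 'b::topological_space"
  assumes "continuous_on UNIV (\<lambda>x. F (torus_of x))"
  shows "continuous_on UNIV F"
  using assms by (simp add: continuous_on_open_vimage open_torus_iff vimage_def)

lemma torus_C2_imp_continuous:
  assumes "torus_C2 g"
  shows "continuous_on UNIV g"
proof (rule continuous_on_torusI)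
  have "isCont (\<lambda>x. g (torus_of x)) x" for x
  proof -
    obtain U G where U: "open U" "x \<in> U" "C2_on U G" "\<forall>y\<in>U. torus_of (G y) = g (torus_of y)"
      using assms unfolding torus_C2_def by blast
    have "continuous_on U G"
      using U(1,3) unfolding C2_on_def
      by (metis continuous_at_imp_continuous_on has_derivative_continuous)
    then have "continuous_on U (\<lambda>y. torus_of (G y))"
      by (rule continuous_on_compose2[OF continuous_on_torus_of]) auto
    then have "continuous_on U (\<lambda>y. g (torus_of y))"
      using U(4) by (simp cong: continuous_on_cong)
    then show ?thesis using U(1,2) by (simp add: continuous_on_eq_continuous_at)
  qed
  then show "continuous_on UNIV (\<lambda>x. g (torus_of x))" by (simp add: continuous_on_eq_continuous_at)
qed

text \<open>Each coordinate of a torus map gives a circle-valued, hence nonvanishing, function on Euclidean space,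
  and such a function has a continuous logarithm because the space is contractible. The imaginary parts of
  the logarithms are the coordinates of a lift.\<close>

lemma ex_continuous_lift:
  fixes g :: "'n::finite torus \<Rightarrow> 'n torus"
  assumes "continuous_on UNIV g"
  obtains G where "continuous_on UNIV G" "\<And>x. torus_of (G x) = g (torus_of x)"
proof -
  \<comment> \<open>The coordinate \<open>j\<close> of \<open>p\<close> as a point of the unit circle.\<close>
  define ch where "ch j p = exp (\<i> * complex_of_real (2 * pi * rep_torus p $ j))" for j :: 'n and p
  have rep: "torus_of (rep_torus p) = p" for p :: "'n torus"
    by (metis Quotient_torus Quotient_abs_rep)
  have ch_of: "ch j (torus_of x) = exp (\<i> * complex_of_real (2 * pi * x $ j))" for j x
  proof -
    have "rep_torus (torus_of x) - x \<in> int_lattice"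
      using rep[of "torus_of x"] by (simp add: torus_of_eq_iff_lattice)
    then obtain n where "rep_torus (torus_of x) $ j - x $ j = of_int n"
      by (auto simp: int_lattice_def elim: Ints_cases)
    then have "rep_torus (torus_of x) $ j = x $ j + of_int n" by simp
    then show ?thesis unfolding ch_def exp_eq by (auto simp: algebra_simps)
  qed
  have "continuous_on UNIV (ch j)" for j
    by (rule continuous_on_torusI) (auto simp: ch_of intro!: continuous_intros)
  then have cont: "continuous_on UNIV (\<lambda>x. ch j (g (torus_of x)))" for j
    by (rule continuous_on_compose2[OF _ continuous_on_compose2[OF assms continuous_on_torus_of]])
      auto
  have "\<exists>L. continuous_on UNIV L \<and> (\<forall>x. ch j (g (torus_of x)) = exp (L x))" for j
    by (rule continuous_logarithm_on_contractible[OF cont[of j] contractible_UNIV])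
      (auto simp: ch_def)
  then obtain L where L: "\<And>j. continuous_on UNIV (L j)"
      "\<And>j x. ch j (g (torus_of x)) = exp (L j x)"
    by metis
  define G where "G x = (\<chi> j. Im (L j x) / (2 * pi))" for x
  have "continuous_on UNIV G"
    unfolding G_def by (intro continuous_intros L(1)) auto
  moreover have "torus_of (G x) = g (torus_of x)" for x
  proof -
    let ?r = "rep_torus (g (torus_of x))"
    have "G x $ j - ?r $ j \<in> \<int>" for j
    proof -
      obtain n :: int where "L j x = \<i> * complex_of_real (2 * pi * ?r $ j) + (of_int (2 * n) * pi) * \<i>"
        using L(2)[of j x, symmetric] unfolding ch_def exp_eq by blast
      then have "Im (L j x) = 2 * pi * ?r $ j + 2 * pi * of_int n" by simp
      then have "G x $ j = ?r $ j + of_int n" by (simp add: G_def field_simps)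
      then show ?thesis by simp
    qed
    then have "torus_of (G x) = torus_of ?r" by (simp add: torus_of_eq_iff_lattice int_lattice_def)
    then show ?thesis by (simp add: rep)
  qed
  ultimately show thesis using that by blast
qed

text \<open>The periods form a group, and the coordinate vectors generate the lattice.\<close>

lemma periods_contain_lattice:
  fixes \<phi> :: "real ^ 'n::finite \<Rightarrow> 'b"
  assumes axis: "\<And>j x. \<phi> (x + axis j 1) = \<phi> x" and "m \<in> int_lattice"
  shows "\<phi> (x + m) = \<phi> x"
proof -
  define P where "P = {m. \<forall>x. \<phi> (x + m) = \<phi> x}"
  have add: "a + b \<in> P" if "a \<in> P" "b \<in> P" for a b
    using that by (simp add: P_def add.assoc[symmetric])
  have neg: "- a \<in> P" if "a \<in> P" for a
  proof -
    have "\<phi> (y + - a) = \<phi> y" for y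
    proof -
      have "\<phi> (y - a + a) = \<phi> (y - a)" using that unfolding P_def by blast
      then show ?thesis by simp
    qed
    then show ?thesis by (simp add: P_def)
  qed
  have "0 \<in> P" by (simp add: P_def)
  have nat: "real n *s axis j 1 \<in> P" for n j
  proof (induction n)
    case (Suc n)
    have "axis j 1 \<in> P" using axis by (simp add: P_def)
    from add[OF this Suc] show ?case by (simp add: vec.scale_left_distrib)
  qed (simp add: \<open>0 \<in> P\<close>)
  have int: "real_of_int k *s axis j 1 \<in> P" for k j
    by (cases k rule: int_cases2) (use nat neg[OF nat] in \<open>auto simp: vec.scale_minus_left\<close>)
  have "(\<Sum>j\<in>J. m $ j *s axis j 1) \<in> P" for J :: "'n set"
  proof (induction J rule: infinite_finite_induct)
    case (insert j J)
    obtain k where "m $ j = of_int k"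
      using \<open>m \<in> int_lattice\<close> by (auto simp: int_lattice_def elim: Ints_cases)
    then have "m $ j *s axis j 1 \<in> P" using int by simp
    then show ?case using insert add by simp
  qed (simp_all add: \<open>0 \<in> P\<close>)
  from this[of UNIV] have "m \<in> P" by (simp add: basis_expansion)
  then show ?thesis by (simp add: P_def)
qed

section \<open>Maps commuting with a linear Anosov diffeomorphism are affine\<close>

lemma bounded_range_of_lattice_periodic:
  fixes \<phi> :: "real ^ 'n::finite \<Rightarrow> 'b::metric_space"
  assumes cont: "continuous_on UNIV \<phi>" and per: "\<And>x m. m \<in> int_lattice \<Longrightarrow> \<phi> (x + m) = \<phi> x"
  shows "bounded (range \<phi>)"
proof -
  have "\<phi> x \<in> \<phi> ` cbox 0 1" for x
  proof -
    define m :: "real ^ 'n" where "m = (\<chi> i. - real_of_int \<lfloor>x $ i\<rfloor>)"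
    have "m \<in> int_lattice" by (simp add: m_def int_lattice_def)
    moreover have "x + m \<in> cbox 0 1"
      by (auto simp: mem_box_cart m_def) linarith
    ultimately show ?thesis using per[of m x] by (metis image_eqI)
  qed
  then have "range \<phi> \<subseteq> \<phi> ` cbox 0 1" by blast
  moreover have "bounded (\<phi> ` cbox 0 1)"
    by (intro compact_imp_bounded compact_continuous_image continuous_on_subset[OF cont]) auto
  ultimately show ?thesis using bounded_subset by blast
qed

text \<open>This is used to extract the linear part of an identity that holds up to bounded terms.\<close>

lemma linear_bounded_range_imp_zero:
  fixes D :: "'a::real_vector \<Rightarrow> 'b::real_normed_vector"
  assumes "linear D" and "bounded (range D)"
  shows "D x = 0"
proof (rule ccontr)
  assume nz: "D x \<noteq> 0"
  obtain K where K: "\<And>x. norm (D x) \<le> K" using assms(2) by (auto simp: bounded_iff)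
  obtain n :: nat where "K < of_nat n * norm (D x)"
    using reals_Archimedean3[of "norm (D x)"] nz by auto
  moreover have "norm (D (of_nat n *\<^sub>R x)) = of_nat n * norm (D x)"
    by (simp add: linear_cmul[OF assms(1)])
  ultimately show False using K[of "of_nat n *\<^sub>R x"] by simp
qed

lemma ex_inverse_of_int_matrix:
  fixes A :: "int ^ 'n::finite ^ 'n"
  assumes "\<bar>det A\<bar> = 1"
  obtains Q where "Q ** map_matrix real_of_int A = mat 1" "map_matrix real_of_int A ** Q = mat 1"
proof -
  have "det (map_matrix real_of_int A) = real_of_int (det A)"
    by (simp add: det_def map_matrix_def)
  then have "invertible (map_matrix real_of_int A)" using assms by (auto simp: invertible_det_nz)
  then show thesis using that unfolding invertible_def by blast
qed

text \<open>The theorem of Adler and Palais. The lift \<open>G\<close> of \<open>g\<close> is the sum of a linear map and a bounded map, and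
  \<open>G (A x) - A (G x)\<close> is constant. The linear part of this identity says that the matrices commute, the
  bounded part is a cohomological equation \<open>\<phi> (A x) = A (\<phi> x) + k\<close> that has only constant solutions
  because \<open>A\<close> is hyperbolic.\<close>

lemma commuting_with_anosov_is_affine:
  fixes f g :: "'n::finite torus \<Rightarrow> 'n torus"
  assumes f: "linear_anosov f" and g: "continuous_on UNIV g" and comm: "g \<circ> f = f \<circ> g"
  obtains B c where "\<And>x. g (torus_of x) = torus_of (B *v x + c)"
proof -
  obtain A0 where A0: "\<bar>det A0\<bar> = 1" "\<forall>c. complex_eigenvalue A0 c \<longrightarrow> cmod c \<noteq> 1" "f = torus_linear A0"
    using f unfolding linear_anosov_def by blast
  define A where "A = map_matrix real_of_int A0"
  obtain Q where Q: "Q ** A = mat 1" "A ** Q = mat 1"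
    using ex_inverse_of_int_matrix[OF A0(1)] unfolding A_def by blast
  have f_of: "f (torus_of x) = torus_of (A *v x)" for x
    unfolding A0(3) A_def by (rule torus_linear.abs_eq)
  obtain G where G: "continuous_on UNIV G" "\<And>x. torus_of (G x) = g (torus_of x)"
    using ex_continuous_lift[OF g] by blast
  have G_cont: "continuous_on S (\<lambda>x. G (h x))" if "continuous_on S h" for S :: "(real ^ 'n) set" and h
    by (rule continuous_on_compose2[OF G(1) that]) simp
  have G_lattice: "G (x + m) - G x \<in> int_lattice" if "m \<in> int_lattice" for x m
    using that by (simp add: torus_of_eq_iff_lattice[symmetric] G(2))
  \<comment> \<open>The translation behaviour of \<open>G\<close> does not depend on the base point; the columns of \<open>B\<close> record it.\<close>
  have incr: "G (x + m) - G x = G m - G 0" if "m \<in> int_lattice" for x m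
  proof -
    have "continuous_on UNIV (\<lambda>x. G (x + m) - G x)" by (intro continuous_intros G_cont)
    from continuous_lattice_valued_constant[OF this G_lattice[OF that], of x 0] show ?thesis by simp
  qed
  have axis_lattice: "axis j 1 \<in> int_lattice" for j :: 'n
    by (simp add: int_lattice_def axis_def)
  define B where "B = (\<chi> i j. (G (axis j 1) - G 0) $ i)"
  have B_axis: "B *v axis j 1 = G (axis j 1) - G 0" for j
    by (simp add: matrix_vector_mult_basis B_def column_def vec_eq_iff)
  define \<phi> where "\<phi> x = G x - B *v x" for x
  have \<phi>_cont: "continuous_on S (\<lambda>x. \<phi> (h x))" if "continuous_on S h" for S :: "(real ^ 'n) set" and h
    unfolding \<phi>_def by (intro continuous_intros G_cont that matrix_vector_mult_linear_continuous_on
        continuous_on_compose2[OF matrix_vector_mult_linear_continuous_on that]) auto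
  have \<phi>_per: "\<phi> (x + m) = \<phi> x" if "m \<in> int_lattice" for x m
  proof (rule periods_contain_lattice[where \<phi> = \<phi>, OF _ that])
    show "\<phi> (x + axis j 1) = \<phi> x" for x j
      using incr[OF axis_lattice, of x j]
      by (simp add: \<phi>_def matrix_vector_right_distrib B_axis algebra_simps)
  qed
  have "bounded (range \<phi>)"
    using bounded_range_of_lattice_periodic[of \<phi>] \<phi>_cont[of UNIV "\<lambda>x. x"] \<phi>_per by simp
  then obtain K where K: "\<And>x. norm (\<phi> x) \<le> K" by (auto simp: bounded_iff)
  have lin: "linear (\<lambda>x. M *v x)" for M :: "real ^ 'n ^ 'n" by simp
  obtain KA where KA: "\<And>x. norm (A *v x) \<le> norm x * KA"
    using bounded_linear.bounded[OF matrix_vector_mul_bounded_linear[of A]] by blast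
  define H where "H x = G (A *v x) - A *v G x" for x
  have "H x \<in> int_lattice" for x
  proof -
    have "torus_of (G (A *v x)) = torus_of (A *v G x)"
      unfolding G(2) f_of[symmetric] using comm by (metis comp_apply)
    then show ?thesis by (simp add: torus_of_eq_iff_lattice H_def)
  qed
  moreover have "continuous_on UNIV H"
    unfolding H_def
    by (intro continuous_intros G_cont matrix_vector_mult_linear_continuous_on
        continuous_on_compose2[OF matrix_vector_mult_linear_continuous_on G(1)]) auto
  ultimately have H_const: "H x = H 0" for x by (intro continuous_lattice_valued_constant[of H])
  define k where "k = H 0"
  \<comment> \<open>All terms except for the commutator of \<open>A\<close> and \<open>B\<close> are bounded in \<open>x\<close>.\<close>
  have H_eq: "\<phi> (A *v x) - A *v \<phi> x + ((B ** A) *v x - (A ** B) *v x) = k" for x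
    unfolding k_def H_const[of x, symmetric]
    by (simp add: H_def \<phi>_def matrix_vector_mult_diff_distrib matrix_vector_mul_assoc)
  have "(B ** A) *v x - (A ** B) *v x = 0" for x
  proof (rule linear_bounded_range_imp_zero[where D = "\<lambda>x. (B ** A) *v x - (A ** B) *v x"])
    show "linear (\<lambda>x. (B ** A) *v x - (A ** B) *v x)" by (intro linear_compose_sub lin)
    have "norm ((B ** A) *v x - (A ** B) *v x) \<le> norm k + K + K * \<bar>KA\<bar>" for x
    proof -
      have "norm (A *v \<phi> x) \<le> K * \<bar>KA\<bar>"
        by (rule order.trans[OF KA], rule order.trans[OF mult_left_mono[OF abs_ge_self]])
          (use K[of x] in \<open>auto intro: mult_right_mono\<close>)
      moreover have "(B ** A) *v x - (A ** B) *v x = k - \<phi> (A *v x) + A *v \<phi> x"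
        using H_eq[of x] by (simp add: algebra_simps)
      ultimately show ?thesis
        using norm_triangle_ineq[of "k - \<phi> (A *v x)" "A *v \<phi> x"]
          norm_triangle_ineq4[of k "\<phi> (A *v x)"] K[of "A *v x"] by simp
    qed
    then show "bounded (range (\<lambda>x. (B ** A) *v x - (A ** B) *v x))"
      unfolding bounded_iff by blast
  qed
  with H_eq have \<phi>_A: "\<phi> (A *v x) = A *v \<phi> x + k" for x by (simp add: algebra_simps)
  have lin_sub: "linear (\<lambda>x. x - A *v x)" by (intro linear_compose_sub lin linear_ident)
  \<comment> \<open>A fixed vector of \<open>A\<close> is a bounded orbit, so \<open>A\<close> has no eigenvalue one, and the constant \<open>k\<close>
    can be absorbed into a translation of \<open>\<phi>\<close>.\<close>
  have "inj (\<lambda>x. x - A *v x)"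
  proof (rule linear_injective_0[THEN iffD2])
    show "linear (\<lambda>x. x - A *v x)" by (rule lin_sub)
    show "\<forall>x. x - A *v x = 0 \<longrightarrow> x = 0"
      using hyperbolic_bounded_orbit_zero[OF A0(2) Q[unfolded A_def], of "\<lambda>_. x" for x]
      unfolding A_def by auto
  qed
  then have "surj (\<lambda>x. x - A *v x)"
    by (intro linear_injective_imp_surjective lin_sub refl)
  then obtain c where c: "k = c - A *v c" by (metis surjD)
  have \<phi>_c: "\<phi> x = c" for x
  proof -
    \<comment> \<open>The two-sided \<open>A\<close>-orbit of \<open>x\<close>.\<close>
    define it where "it j = (if j \<ge> 0 then (((*v) A) ^^ nat j) x else (((*v) Q) ^^ nat (- j)) x)" for j :: int
    have it_step: "it (j + 1) = A *v it j" for j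
    proof (cases "j \<ge> 0")
      case True
      then have "nat (j + 1) = Suc (nat j)" by simp
      then show ?thesis using True by (simp add: it_def)
    next
      case False
      then have *: "nat (- j) = Suc (nat (- (j + 1)))" by simp
      have "A *v it j = (((*v) Q) ^^ nat (- (j + 1))) x"
        using False unfolding it_def * by (simp add: matrix_vector_mul_assoc Q)
      then show ?thesis using False by (cases "j = -1") (auto simp: it_def)
    qed
    define v where "v j = \<phi> (it j) - c" for j
    have "v 0 = 0"
    proof (rule hyperbolic_bounded_orbit_zero[where v = v, OF A0(2) Q[unfolded A_def]])
      show "v (j + 1) = map_matrix real_of_int A0 *v v j" for j
        unfolding v_def it_step \<phi>_A A_def[symmetric] matrix_vector_mult_diff_distrib by (simp add: c)
      have "norm (v j) \<le> K + norm c" for j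
        unfolding v_def using norm_triangle_ineq4[of "\<phi> (it j)" c] K[of "it j"] by simp
      then show "bounded (range v)" unfolding bounded_iff by blast
    qed
    then show ?thesis by (simp add: v_def it_def)
  qed
  have G_eq: "G x = B *v x + c" for x using \<phi>_c[of x] by (simp add: \<phi>_def algebra_simps)
  show thesis
  proof (rule that)
    show "g (torus_of x) = torus_of (B *v x + c)" for x using G(2)[of x] G_eq by simp
  qed
qed

text \<open>The lift of the identity differs from \<open>x\<close> by a continuous integer valued function, which is constant.\<close>

lemma affine_diffeo_matrices_inverse:
  fixes g h :: "'n::finite torus \<Rightarrow> 'n torus"
  assumes g: "\<And>x. g (torus_of x) = torus_of (B *v x + c)"
    and h: "\<And>x. h (torus_of x) = torus_of (Q *v x + d)" and gh: "\<And>p. g (h p) = p"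
  shows "B ** Q = mat 1"
proof -
  define H where "H x = B *v (Q *v x + d) + c - x" for x
  have "H x \<in> int_lattice" for x
    using gh[of "torus_of x"] by (simp add: g h torus_of_eq_iff_lattice H_def)
  moreover have "continuous_on UNIV H"
    unfolding H_def
    by (intro continuous_intros matrix_vector_mult_linear_continuous_on
        continuous_on_compose2[OF matrix_vector_mult_linear_continuous_on[of UNIV B]]) auto
  ultimately have "H x = H 0" for x by (intro continuous_lattice_valued_constant[of H])
  then have "B *v (Q *v x) - x = 0" for x
    by (simp add: H_def matrix_vector_right_distrib algebra_simps)
  then show ?thesis by (simp add: matrix_eq matrix_vector_mul_assoc)
qed

section \<open>Affine bijections preserve Lebesgue measure\<close>

definition unit_cube :: "(real ^ 'n::finite) set" where
  "unit_cube = {x. \<forall>i. 0 \<le> x $ i \<and> x $ i < 1}"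

lemma unit_cube_borel: "unit_cube \<in> sets borel"
  unfolding unit_cube_def by measurable

lemma torus_of_inj_on_unit_cube: "inj_on torus_of unit_cube"
proof (rule inj_onI)
  fix x y :: "real ^ 'n"
  assume xy: "x \<in> unit_cube" "y \<in> unit_cube" "torus_of x = torus_of y"
  have "(x - y) $ i = 0" for i
  proof (rule Ints_nonzero_abs_less1)
    show "(x - y) $ i \<in> \<int>" using xy(3) by (simp add: torus_of_eq_iff_lattice int_lattice_def)
    have "0 \<le> x $ i" "x $ i < 1" "0 \<le> y $ i" "y $ i < 1" using xy by (auto simp: unit_cube_def)
    then show "\<bar>(x - y) $ i\<bar> < 1" by simp
  qed
  then show "x = y" by (simp add: vec_eq_iff)
qed

lemma countable_int_lattice: "countable (int_lattice :: (real ^ 'n::finite) set)"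
proof (rule countable_subset)
  show "(int_lattice :: (real ^ 'n) set) \<subseteq> range (\<lambda>f :: 'n \<Rightarrow> int. \<chi> i. of_int (f i))"
  proof
    fix m :: "real ^ 'n" assume m: "m \<in> int_lattice"
    have "m = (\<chi> i. of_int \<lfloor>m $ i\<rfloor>)"
      using m by (auto simp: vec_eq_iff int_lattice_def elim!: Ints_cases)
    then show "m \<in> range (\<lambda>f :: 'n \<Rightarrow> int. \<chi> i. of_int (f i))"
      by (rule range_eqI[where x = "\<lambda>i. \<lfloor>m $ i\<rfloor>"])
  qed
qed simp

lemma ex_lattice_shift_into_unit_cube: "\<exists>m\<in>int_lattice. x - m \<in> unit_cube"
proof
  show "(\<chi> i. of_int \<lfloor>x $ i\<rfloor>) \<in> int_lattice" by (simp add: int_lattice_def)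
  show "x - (\<chi> i. of_int \<lfloor>x $ i\<rfloor>) \<in> unit_cube" by (auto simp: unit_cube_def) linarith
qed

lemma lattice_shift_into_unit_cube_unique:
  assumes "m \<in> int_lattice" "m' \<in> int_lattice" "x - m \<in> unit_cube" "x - m' \<in> unit_cube"
  shows "m = m'"
proof -
  have "torus_of (x - m) = torus_of (x - m')"
    using assms(1,2) by (auto simp: torus_of_eq_iff_lattice int_lattice_def)
  then have "x - m = x - m'" using inj_onD[OF torus_of_inj_on_unit_cube] assms(3,4) by blast
  then show ?thesis by simp
qed

lemma torus_of_measurable [measurable]: "torus_of \<in> borel_measurable borel"
  by (intro borel_measurable_continuous_onI continuous_on_torus_of)

lemma emeasure_torus_leb:
  assumes "U \<in> sets borel"
  shows "emeasure torus_leb U = emeasure lborel (unit_cube \<inter> torus_of -` U)"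
proof -
  have V: "torus_of -` U \<in> sets borel" using measurable_sets[OF torus_of_measurable assms] by simp
  have meas: "torus_of \<in> measurable (restrict_space lborel unit_cube) borel"
    by (intro measurable_restrict_space1) simp
  have "emeasure torus_leb U = emeasure (restrict_space lborel unit_cube) (torus_of -` U \<inter> unit_cube)"
    using assms meas unfolding torus_leb_def unit_cube_def
    by (subst emeasure_distr) (auto simp: space_restrict_space Int_commute)
  also have "\<dots> = emeasure lborel (torus_of -` U \<inter> unit_cube)"
    using unit_cube_borel V by (subst emeasure_restrict_space) auto
  finally show ?thesis by (simp add: Int_commute)
qed

text \<open>A lattice periodic set meets every translate of the unit cube in the same volume. Both sets are cut into
  countably many pieces, one for each lattice vector \<open>m\<close>, and translation by \<open>t - m\<close> carries the pieces
  of one set to the pieces of the other.\<close>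

lemma emeasure_unit_cube_shift_periodic:
  fixes U :: "'n::finite torus set"
  assumes U: "U \<in> sets borel"
  shows "emeasure lborel (unit_cube \<inter> {x. torus_of (x + t) \<in> U})
    = emeasure lborel (unit_cube \<inter> torus_of -` U)"
proof -
  define E where "E m = {x \<in> unit_cube. torus_of (x + t) \<in> U \<and> x + t - m \<in> unit_cube}" for m
  define F where "F m = {y \<in> unit_cube. torus_of y \<in> U \<and> y - t + m \<in> unit_cube}" for m
  note [measurable] = U unit_cube_borel
  have E: "E m \<in> sets borel" for m unfolding E_def by measurable
  have F: "F m \<in> sets borel" for m unfolding F_def by measurable
  have E_F: "E m = (\<lambda>x. (t - m) + x) -` F m" if "m \<in> int_lattice" for m
  proof -
    have "torus_of (t - m + x) = torus_of (x + t)" for x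
      using that by (auto simp: torus_of_eq_iff_lattice int_lattice_def)
    then show ?thesis by (auto simp: E_def F_def algebra_simps)
  qed
  have EF: "emeasure lborel (E m) = emeasure lborel (F m)" if "m \<in> int_lattice" for m
  proof -
    have "emeasure lborel (F m) = emeasure (distr lborel borel ((+) (t - m))) (F m)"
      by (simp add: lborel_distr_plus)
    also have "\<dots> = emeasure lborel (E m)"
      unfolding E_F[OF that] using F by (subst emeasure_distr) auto
    finally show ?thesis ..
  qed
  have E_cover: "unit_cube \<inter> {x. torus_of (x + t) \<in> U} = (\<Union>m\<in>int_lattice. E m)"
    using ex_lattice_shift_into_unit_cube[of "x + t" for x] by (force simp: E_def)
  have F_cover: "unit_cube \<inter> torus_of -` U = (\<Union>m\<in>int_lattice. F m)"
  proof (intro equalityI subsetI)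
    fix y assume y: "y \<in> unit_cube \<inter> torus_of -` U"
    obtain m where m: "m \<in> int_lattice" "y - t - m \<in> unit_cube"
      using ex_lattice_shift_into_unit_cube by blast
    then have "- m \<in> int_lattice" by (simp add: int_lattice_def)
    moreover have "y \<in> F (- m)" using y m by (simp add: F_def)
    ultimately show "y \<in> (\<Union>m\<in>int_lattice. F m)" by blast
  qed (auto simp: F_def)
  have E_disj: "disjoint_family_on E int_lattice"
    unfolding disjoint_family_on_def E_def using lattice_shift_into_unit_cube_unique by blast
  have F_disj: "disjoint_family_on F int_lattice"
    unfolding disjoint_family_on_def
  proof (intro ballI impI, rule ccontr)
    fix m m' assume m: "m \<in> int_lattice" "m' \<in> int_lattice" "m \<noteq> m'" "F m \<inter> F m' \<noteq> {}"
    then obtain y where "y - t - (- m) \<in> unit_cube" "y - t - (- m') \<in> unit_cube"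
      by (auto simp: F_def)
    moreover have "- m \<in> int_lattice" "- m' \<in> int_lattice" using m by (auto simp: int_lattice_def)
    ultimately have "- m = - m'" using lattice_shift_into_unit_cube_unique by blast
    then show False using m(3) by simp
  qed
  have "emeasure lborel (unit_cube \<inter> {x. torus_of (x + t) \<in> U})
      = (\<integral>\<^sup>+ m. emeasure lborel (E m) \<partial>count_space int_lattice)"
    unfolding E_cover using E by (intro emeasure_UN_countable countable_int_lattice E_disj) auto
  also have "\<dots> = (\<integral>\<^sup>+ m. emeasure lborel (F m) \<partial>count_space int_lattice)"
    by (intro nn_integral_cong) (simp add: EF)
  also have "\<dots> = emeasure lborel (unit_cube \<inter> torus_of -` U)"
    unfolding F_cover using F
    by (intro emeasure_UN_countable[symmetric] countable_int_lattice F_disj) auto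
  finally show ?thesis .
qed

lemma emeasure_unit_cube: "emeasure lborel (unit_cube :: (real ^ 'n::finite) set) = 1"
proof -
  have "emeasure (torus_leb :: 'n torus measure) UNIV = 1"
    using emeasure_space_torus_leb by (simp add: torus_leb_def)
  then show ?thesis by (simp add: emeasure_torus_leb)
qed

text \<open>Uniqueness of Haar measure. The double integral measures the pairs \<open>(x, t)\<close> in the unit cube such that
  the image of \<open>x\<close>, translated by \<open>t\<close>, lies in \<open>U\<close>. Integration over \<open>x\<close> first gives the measure of
  the preimage of \<open>U\<close>, since translating the image by \<open>t\<close> amounts to translating \<open>x\<close> by \<open>Q t\<close>;
  integration over \<open>t\<close> first gives the measure of \<open>U\<close>.\<close>

lemma torus_leb_vimage_affine:
  fixes g :: "'n::finite torus \<Rightarrow> 'n torus"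
  assumes g: "\<And>x. g (torus_of x) = torus_of (B *v x + c)" and BQ: "B ** Q = mat 1"
    and U: "U \<in> sets borel" and gU: "g -` U \<in> sets borel"
  shows "emeasure torus_leb (g -` U) = emeasure torus_leb U"
proof -
  note [measurable] = U unit_cube_borel
  have B [measurable]: "(*v) B \<in> borel_measurable borel"
    by (intro borel_measurable_continuous_onI matrix_vector_mult_linear_continuous_on)
  let ?Q = "unit_cube :: (real ^ 'n) set"
  define I where "I x t = indicator ?Q x * indicator ?Q t * (indicator U (torus_of (B *v x + c + t)) :: ennreal)"
    for x t
  have I_meas: "case_prod I \<in> borel_measurable (lborel \<Otimes>\<^sub>M lborel)"
    unfolding I_def by measurable
  have "(\<integral>\<^sup>+ x. I x t \<partial>lborel) = indicator ?Q t * emeasure torus_leb (g -` U)" for t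
  proof -
    define s where "s = Q *v t"
    have "B *v s = t" by (simp add: s_def matrix_vector_mul_assoc BQ)
    then have shift: "torus_of (B *v x + c + t) = g (torus_of (x + s))" for x
      by (simp add: g matrix_vector_right_distrib algebra_simps)
    have S: "?Q \<inter> {x. torus_of (x + s) \<in> g -` U} \<in> sets borel"
      using gU by measurable
    have "(\<integral>\<^sup>+ x. I x t \<partial>lborel)
        = (\<integral>\<^sup>+ x. indicator ?Q t * indicator (?Q \<inter> {x. torus_of (x + s) \<in> g -` U}) x \<partial>lborel)"
      unfolding I_def shift by (intro nn_integral_cong) (auto split: split_indicator)
    also have "\<dots> = indicator ?Q t * emeasure lborel (?Q \<inter> {x. torus_of (x + s) \<in> g -` U})"
      by (rule nn_integral_cmult_indicator) (use S in simp)
    also have "\<dots> = indicator ?Q t * emeasure torus_leb (g -` U)"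
      by (simp only: emeasure_unit_cube_shift_periodic[OF gU] emeasure_torus_leb[OF gU])
    finally show ?thesis .
  qed
  then have "(\<integral>\<^sup>+ t. \<integral>\<^sup>+ x. I x t \<partial>lborel \<partial>lborel) = emeasure torus_leb (g -` U)"
    by (simp add: nn_integral_multc emeasure_unit_cube)
  moreover have "(\<integral>\<^sup>+ t. I x t \<partial>lborel) = indicator ?Q x * emeasure torus_leb U" for x
  proof -
    have S: "?Q \<inter> {t. torus_of (t + (B *v x + c)) \<in> U} \<in> sets borel"
      by measurable
    have "(\<integral>\<^sup>+ t. I x t \<partial>lborel)
        = (\<integral>\<^sup>+ t. indicator ?Q x * indicator (?Q \<inter> {t. torus_of (t + (B *v x + c)) \<in> U}) t \<partial>lborel)"
      unfolding I_def by (intro nn_integral_cong) (auto split: split_indicator simp: add.commute)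
    also have "\<dots> = indicator ?Q x * emeasure lborel (?Q \<inter> {t. torus_of (t + (B *v x + c)) \<in> U})"
      by (rule nn_integral_cmult_indicator) (use S in simp)
    also have "\<dots> = indicator ?Q x * emeasure torus_leb U"
      by (simp only: emeasure_unit_cube_shift_periodic[OF U] emeasure_torus_leb[OF U])
    finally show ?thesis .
  qed
  then have "(\<integral>\<^sup>+ x. \<integral>\<^sup>+ t. I x t \<partial>lborel \<partial>lborel) = emeasure torus_leb U"
    by (simp add: nn_integral_multc emeasure_unit_cube)
  ultimately show ?thesis using lborel_pair.Fubini'[OF I_meas] by simp
qed

section \<open>Entropy of affine maps from expansion rates\<close>

lemma entropy_ge_of_card_separated:
  fixes g :: "'a::metric_space \<Rightarrow> 'a"
  assumes "\<epsilon> > 0" "C > 0"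
    and sep: "\<And>n. n \<ge> 1 \<Longrightarrow> \<exists>S. finite S \<and> separated g n \<epsilon> S \<and> C * exp (real n * h) \<le> real (card S)"
  shows "ereal h \<le> topological_entropy g"
proof -
  let ?N = "\<lambda>n. SUP S\<in>{S. finite S \<and> S \<noteq> {} \<and> separated g n \<epsilon> S}. ereal (ln (real (card S)) / real n)"
  have "ereal (ln C / real n + h) \<le> ?N n" if n: "n \<ge> 1" for n
  proof -
    obtain S where S: "finite S" "separated g n \<epsilon> S" "C * exp (real n * h) \<le> real (card S)"
      using sep[OF n] by blast
    have pos: "0 < C * exp (real n * h)" using \<open>C > 0\<close> by simp
    then have "S \<noteq> {}" using S(3) by auto
    have "ln C + real n * h = ln (C * exp (real n * h))" using \<open>C > 0\<close> by (simp add: ln_mult)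
    also have "\<dots> \<le> ln (real (card S))" using S(3) pos by (subst ln_le_cancel_iff) linarith+
    finally have "(ln C + real n * h) / real n \<le> ln (real (card S)) / real n"
      by (rule divide_right_mono) simp
    then have "ln C / real n + h \<le> ln (real (card S)) / real n"
      using n by (simp add: add_divide_distrib)
    then show ?thesis
      by (intro SUP_upper2[of S]) (use S \<open>S \<noteq> {}\<close> in auto)
  qed
  then have "limsup (\<lambda>n. ereal (ln C / real n + h)) \<le> limsup ?N"
    by (intro Limsup_mono eventually_sequentiallyI[of 1]) auto
  moreover have "(\<lambda>n. ln C / real n + h) \<longlonglongrightarrow> 0 + h"
    by (intro tendsto_intros lim_const_over_n)
  then have "limsup (\<lambda>n. ereal (ln C / real n + h)) = ereal h"
    by (intro lim_imp_Limsup) simp_all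
  ultimately have "ereal h \<le> limsup ?N" by simp
  also have "\<dots> \<le> topological_entropy g"
    unfolding topological_entropy_def by (rule SUP_upper) (use \<open>\<epsilon> > 0\<close> in simp)
  finally show ?thesis .
qed

text \<open>The projection to the torus is an isometry at small scales: a nonzero lattice vector has length at least
  one.\<close>

lemma norm_less_of_torus_dist_less:
  fixes x y :: "real ^ 'n::finite"
  assumes "dist (torus_of x) (torus_of y) < e" and "norm (x - y) + e \<le> 1"
  shows "norm (x - y) < e"
proof -
  obtain y' where y': "torus_of y' = torus_of y" "norm (x - y') < e"
    using torus_dist_less[OF assms(1)] by blast
  have "norm (y' - y) \<le> norm (x - y) + norm (x - y')"
    using norm_triangle_ineq4[of "x - y" "x - y'"] by simp
  also have "\<dots> < 1" using y'(2) assms(2) by simp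
  finally have lt: "norm (y' - y) < 1" .
  have "y' - y \<in> int_lattice" using y'(1) by (simp add: torus_of_eq_iff_lattice)
  have "(y' - y) $ i = 0" for i
  proof (rule Ints_nonzero_abs_less1)
    show "(y' - y) $ i \<in> \<int>" using \<open>y' - y \<in> int_lattice\<close> by (auto simp: int_lattice_def)
    show "\<bar>(y' - y) $ i\<bar> < 1" using component_le_norm_cart[of "y' - y" i] lt by linarith
  qed
  then have "y' = y" by (simp add: vec_eq_iff)
  then show ?thesis using y' by simp
qed

lemma linear_funpow: "linear T \<Longrightarrow> linear (T ^^ n)" for T :: "'a::real_vector \<Rightarrow> 'a"
proof (induction n)
  case (Suc n)
  then show ?case using linear_compose[OF Suc.IH, of T] by (simp add: o_def)
qed (simp add: id_def linear_ident)

lemma linear_funpow_matrix: "linear (((*v) B) ^^ k)" for B :: "real ^ 'n::finite ^ 'n"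
  by (rule linear_funpow) simp

lemma affine_torus_map_funpow:
  fixes g :: "'n::finite torus \<Rightarrow> 'n torus"
  assumes "\<And>x. g (torus_of x) = torus_of (B *v x + c)"
  shows "\<exists>d. \<forall>x. (g ^^ k) (torus_of x) = torus_of ((((*v) B) ^^ k) x + d)"
proof (induction k)
  case 0 then show ?case by (auto intro: exI[of _ 0])
next
  case (Suc k)
  then obtain d where "\<And>x. (g ^^ k) (torus_of x) = torus_of ((((*v) B) ^^ k) x + d)" by blast
  then have "(g ^^ Suc k) (torus_of x) = torus_of ((((*v) B) ^^ Suc k) x + (B *v d + c))" for x
    by (simp add: assms matrix_vector_right_distrib add.assoc)
  then show ?case by blast
qed

text \<open>In one step a displacement of length less than \<open>e\<close> grows to at most \<open>M * e\<close>. By the choice of \<open>e\<close> this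
  is still in the range where the distance on the torus determines the displacement of the lifts, so
  closeness of orbits on the torus can be followed upstairs step by step.\<close>

lemma orbit_close_imp_lift_close:
  fixes g :: "'n::finite torus \<Rightarrow> 'n torus"
  assumes g: "\<And>x. g (torus_of x) = torus_of (B *v x + c)"
    and M: "\<And>x. norm (B *v x) \<le> M * norm x" "0 \<le> M" and e: "M * e + e \<le> 1"
    and close: "\<And>k. k < n \<Longrightarrow> dist ((g ^^ k) (torus_of x)) ((g ^^ k) (torus_of y)) < e"
    and start: "norm (x - y) + e \<le> 1"
  shows "k < n \<Longrightarrow> norm ((((*v) B) ^^ k) (x - y)) < e"
proof (induction k)
  case 0
  then show ?case using norm_less_of_torus_dist_less[OF _ start] close[of 0] by simp
next
  case (Suc k)
  obtain d where d: "\<And>x. (g ^^ Suc k) (torus_of x) = torus_of ((((*v) B) ^^ Suc k) x + d)"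
    using affine_torus_map_funpow[of g B c "Suc k"] g by blast
  have diff: "(((*v) B) ^^ Suc k) x + d - ((((*v) B) ^^ Suc k) y + d) = (((*v) B) ^^ Suc k) (x - y)"
    by (simp only: linear_diff[OF linear_funpow_matrix] add_diff_cancel_right)
  have "norm ((((*v) B) ^^ Suc k) (x - y)) \<le> M * norm ((((*v) B) ^^ k) (x - y))"
    using M(1) by simp
  also have "\<dots> \<le> M * e" using Suc M(2) by (intro mult_left_mono) auto
  finally have "norm ((((*v) B) ^^ Suc k) (x - y)) + e \<le> 1" using e by simp
  then show ?case
    using norm_less_of_torus_dist_less[of "(((*v) B) ^^ Suc k) x + d" "(((*v) B) ^^ Suc k) y + d" e]
      close[OF Suc.prems] unfolding d diff by simp
qed

text \<open>Two points of \<open>X\<close> that stay close along the orbit would have lifts that stay close, up to time \<open>m\<close>.\<close>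

lemma separated_torus_of_image:
  fixes g :: "'n::finite torus \<Rightarrow> 'n torus"
  assumes g: "\<And>x. g (torus_of x) = torus_of (B *v x + c)"
    and M: "\<And>x. norm (B *v x) \<le> M * norm x" "0 \<le> M" and e: "M * e + e \<le> 1" "0 < e"
    and X: "\<And>x y. x \<in> X \<Longrightarrow> y \<in> X \<Longrightarrow> norm (x - y) + e \<le> 1"
    and far: "\<And>x y. x \<in> X \<Longrightarrow> y \<in> X \<Longrightarrow> x \<noteq> y \<Longrightarrow> e \<le> norm ((((*v) B) ^^ m) (x - y))"
  shows "inj_on torus_of X \<and> separated g (Suc m) (e / 2) (torus_of ` X)"
proof -
  have key: "\<exists>k<Suc m. dist ((g ^^ k) (torus_of x)) ((g ^^ k) (torus_of y)) > e / 2"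
    if "x \<in> X" "y \<in> X" "x \<noteq> y" for x y
  proof (rule ccontr)
    assume "\<not> ?thesis"
    then have "dist ((g ^^ k) (torus_of x)) ((g ^^ k) (torus_of y)) \<le> e / 2" if "k < Suc m" for k
      using that not_less by blast
    then have "dist ((g ^^ k) (torus_of x)) ((g ^^ k) (torus_of y)) < e" if "k < Suc m" for k
      using that e(2) by fastforce
    then have "norm ((((*v) B) ^^ m) (x - y)) < e"
      using orbit_close_imp_lift_close[of g B c M e "Suc m" x y m] g M e X[OF that(1,2)] by blast
    then show False using far[OF that] by simp
  qed
  have "inj_on torus_of X"
  proof (rule inj_onI, rule ccontr)
    fix x y assume "x \<in> X" "y \<in> X" "torus_of x = torus_of y" "x \<noteq> y"
    then show False using key[of x y] e(2) by auto
  qed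
  moreover have "separated g (Suc m) (e / 2) (torus_of ` X)"
    unfolding separated_def using key by blast
  ultimately show ?thesis by blast
qed

text \<open>The hypothesis says that, up to the factor \<open>C\<close>, the map \<open>B ^^ n\<close> expands the coefficient in the
  direction of \<open>v b\<close> by \<open>exp (n * r b)\<close>, whatever the other coefficients are. Hence the points of a
  grid with mesh \<open>\<tau> b\<close> proportional to \<open>exp (- n * r b)\<close> are separated at time \<open>n\<close>. A piece of the grid of fixed diameter
  has at least a constant times \<open>exp (n * (\<Sum>b\<in>S. r b))\<close> points.\<close>

lemma entropy_ge_sum_expansion_rates:
  fixes g :: "'n::finite torus \<Rightarrow> 'n torus" and S :: "'i set" and v :: "'i \<Rightarrow> real ^ 'n" and r :: "'i \<Rightarrow> real"
  assumes g: "\<And>x. g (torus_of x) = torus_of (B *v x + c)"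
    and S: "finite S" and C: "C > 0"
    and rate: "\<And>a b n. b \<in> S \<Longrightarrow>
      \<bar>a b\<bar> \<le> C * exp (- (real n * r b)) * norm ((((*v) B) ^^ n) (\<Sum>b\<in>S. a b *\<^sub>R v b))"
  shows "ereal (\<Sum>b\<in>S. r b) \<le> topological_entropy g"
proof -
  obtain M where M: "\<And>x. norm (B *v x) \<le> M * norm x" "M > 0"
    using bounded_linear.pos_bounded[OF matrix_vector_mul_bounded_linear[of B]] by (auto simp: mult.commute)
  define e where "e = 1 / (M + 1)"
  have e: "0 < e" "M * e + e \<le> 1" "e < 1" using M(2) by (auto simp: e_def field_simps)
  \<comment> \<open>Coefficients up to \<open>\<rho>\<close> keep the grid in a set of diameter at most \<open>1 - e\<close>.\<close>
  define \<rho> where "\<rho> = (1 - e) / ((\<Sum>b\<in>S. norm (v b)) + 1)"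
  have den: "(\<Sum>b\<in>S. norm (v b)) + 1 > 0" by (simp add: sum_nonneg add_nonneg_pos)
  have \<rho>: "\<rho> > 0" using e den by (simp add: \<rho>_def)
  have \<rho>_sum: "(\<Sum>b\<in>S. \<rho> * norm (v b)) \<le> 1 - e"
  proof -
    have "(\<Sum>b\<in>S. \<rho> * norm (v b)) \<le> \<rho> * ((\<Sum>b\<in>S. norm (v b)) + 1)"
      using \<rho> by (simp add: sum_distrib_left algebra_simps)
    also have "\<dots> = 1 - e" using den by (simp add: \<rho>_def)
    finally show ?thesis .
  qed
  define R where "R = (\<Sum>b\<in>S. r b)"
  define K where "K = (\<rho> / (C * e)) ^ card S * exp (- R)"
  have "\<exists>T. finite T \<and> separated g n (e / 2) T \<and> K * exp (real n * R) \<le> real (card T)"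
    if n: "n \<ge> 1" for n
  proof -
    \<comment> \<open>Separation in \<open>n\<close> steps looks at the iterates up to \<open>m\<close> only, whence the factor \<open>exp (- R)\<close> in \<open>K\<close>.\<close>
    obtain m where m: "n = Suc m" using n by (cases n) auto
    define \<tau> where "\<tau> b = C * e * exp (- (real m * r b))" for b
    have \<tau>: "\<tau> b > 0" for b using C e by (simp add: \<tau>_def)
    define N where "N b = Suc (nat \<lfloor>\<rho> / \<tau> b\<rfloor>)" for b
    define I where "I = PiE S (\<lambda>b. {..<N b})"
    define p where "p k = (\<Sum>b\<in>S. (real (k b) * \<tau> b) *\<^sub>R v b)" for k
    have range: "0 \<le> real (k b) * \<tau> b" "real (k b) * \<tau> b \<le> \<rho>" if "k \<in> I" "b \<in> S" for k b
    proof -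
      have "k b \<le> nat \<lfloor>\<rho> / \<tau> b\<rfloor>" using that PiE_mem[of k S "\<lambda>b. {..<N b}" b] by (simp add: I_def N_def less_Suc_eq_le)
      then have "real (k b) \<le> \<rho> / \<tau> b"
        using \<rho> \<tau>[of b] by (simp add: le_nat_floor le_nat_iff le_floor_iff)
      then show "real (k b) * \<tau> b \<le> \<rho>" using \<tau>[of b] by (simp add: field_simps)
      show "0 \<le> real (k b) * \<tau> b" using \<tau>[of b] by simp
    qed
    have diff: "p k - p l = (\<Sum>b\<in>S. (real (k b) * \<tau> b - real (l b) * \<tau> b) *\<^sub>R v b)" for k l
      by (simp add: p_def sum_subtractf scaleR_left_diff_distrib)
    have near: "norm (p k - p l) + e \<le> 1" if "k \<in> I" "l \<in> I" for k l
    proof -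
      have "norm (p k - p l) \<le> (\<Sum>b\<in>S. \<bar>real (k b) * \<tau> b - real (l b) * \<tau> b\<bar> * norm (v b))"
        unfolding diff by (rule order.trans[OF norm_sum]) simp
      also have "\<dots> \<le> (\<Sum>b\<in>S. \<rho> * norm (v b))"
      proof (intro sum_mono mult_right_mono)
        fix b assume "b \<in> S"
        then show "\<bar>real (k b) * \<tau> b - real (l b) * \<tau> b\<bar> \<le> \<rho>"
          using range[OF that(1), of b] range[OF that(2), of b] by simp
      qed simp
      finally show ?thesis using \<rho>_sum by simp
    qed
    have eq: "k = l" if k: "k \<in> I" and l: "l \<in> I" and lt: "norm ((((*v) B) ^^ m) (p k - p l)) < e" for k l
    proof (rule PiE_ext)
      fix b assume b: "b \<in> S"
      have pos: "0 < C * exp (- (real m * r b))" using C by simp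
      have "\<bar>real (k b) * \<tau> b - real (l b) * \<tau> b\<bar>
          \<le> C * exp (- (real m * r b)) * norm ((((*v) B) ^^ m) (p k - p l))"
        unfolding diff using rate[OF b, of "\<lambda>b. real (k b) * \<tau> b - real (l b) * \<tau> b" m] by simp
      also have "\<dots> < C * exp (- (real m * r b)) * e"
        by (rule mult_strict_left_mono[OF lt pos])
      also have "\<dots> = \<tau> b" by (simp add: \<tau>_def)
      also have "real (k b) * \<tau> b - real (l b) * \<tau> b = (real (k b) - real (l b)) * \<tau> b"
        by (simp add: algebra_simps)
      finally have "\<bar>real (k b) - real (l b)\<bar> < 1" using \<tau>[of b] by (simp add: abs_mult)
      then show "k b = l b" by linarith
    qed (use k l in \<open>auto simp: I_def\<close>)
    have "inj_on p I"
    proof (rule inj_onI)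
      fix k l assume "k \<in> I" "l \<in> I" "p k = p l"
      then show "k = l" using eq[of k l] linear_0[OF linear_funpow_matrix, of m B] e(1) by simp
    qed
    have far: "e \<le> norm ((((*v) B) ^^ m) (x - y))" if "x \<in> p ` I" "y \<in> p ` I" "x \<noteq> y" for x y
      using that eq by (metis imageE not_le)
    have sep: "inj_on torus_of (p ` I) \<and> separated g n (e / 2) (torus_of ` p ` I)"
      unfolding m
    proof (rule separated_torus_of_image[of g B c M])
      show "norm (x - y) + e \<le> 1" if "x \<in> p ` I" "y \<in> p ` I" for x y
        using that near by blast
    qed (use g M e far in auto)
    have "K * exp (real n * R) = (\<rho> / (C * e)) ^ card S * exp (real m * R)"
      by (simp add: K_def m exp_add[symmetric] algebra_simps)
    also have "\<dots> = (\<Prod>b\<in>S. \<rho> / (C * e) * exp (real m * r b))"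
      using S by (simp add: prod.distrib exp_sum R_def sum_distrib_left del: times_divide_eq_left)
    also have "\<dots> = (\<Prod>b\<in>S. \<rho> / \<tau> b)"
      by (simp add: \<tau>_def exp_minus field_simps)
    also have "\<dots> \<le> (\<Prod>b\<in>S. real (N b))"
    proof (rule prod_mono)
      fix b
      have "\<rho> / \<tau> b \<le> real (N b)" unfolding N_def by linarith
      then show "0 \<le> \<rho> / \<tau> b \<and> \<rho> / \<tau> b \<le> real (N b)" using \<rho> \<tau>[of b] by simp
    qed
    also have "\<dots> = real (card I)" using S by (simp add: I_def card_PiE)
    also have "card I = card (torus_of ` p ` I)"
      using sep \<open>inj_on p I\<close> by (simp add: card_image)
    finally have "K * exp (real n * R) \<le> real (card (torus_of ` p ` I))" .
    moreover have "finite I" unfolding I_def using S by (intro finite_PiE) auto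
    ultimately show ?thesis
      using sep by (intro exI[of _ "torus_of ` p ` I"] conjI) auto
  qed
  moreover have "K > 0" using \<rho> C e by (simp add: K_def)
  ultimately have "ereal R \<le> topological_entropy g"
    using e(1) by (intro entropy_ge_of_card_separated[of "e / 2" K]) auto
  then show ?thesis by (simp add: R_def)
qed

section \<open>Exponential growth of a linear automorphism\<close>

text \<open>The vectors whose forward growth rate, in the sense of the limit superior, is at most \<open>l\<close>.\<close>

definition growth_space :: "('a::real_normed_vector \<Rightarrow> 'a) \<Rightarrow> real \<Rightarrow> 'a set" where
  "growth_space T l = {v. \<forall>\<delta>>0. \<exists>C. \<forall>n. norm ((T ^^ n) v) \<le> C * exp (real n * (l + \<delta>))}"

lemma subspace_growth_space:
  assumes "linear T"
  shows "subspace (growth_space T l)"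
proof (rule subspaceI)
  note lin = linear_funpow[OF assms]
  show "0 \<in> growth_space T l"
    by (auto simp: growth_space_def linear_0[OF lin] intro: exI[of _ 0])
  show "x + y \<in> growth_space T l" if x: "x \<in> growth_space T l" and y: "y \<in> growth_space T l" for x y
    unfolding growth_space_def
  proof (safe)
    fix \<delta> :: real assume "\<delta> > 0"
    obtain C where C: "\<And>n. norm ((T ^^ n) x) \<le> C * exp (real n * (l + \<delta>))"
      using x \<open>\<delta> > 0\<close> unfolding growth_space_def by blast
    obtain D where D: "\<And>n. norm ((T ^^ n) y) \<le> D * exp (real n * (l + \<delta>))"
      using y \<open>\<delta> > 0\<close> unfolding growth_space_def by blast
    have "norm ((T ^^ n) (x + y)) \<le> (C + D) * exp (real n * (l + \<delta>))" for n
      unfolding linear_add[OF lin] distrib_right by (rule norm_triangle_mono[OF C D])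
    then show "\<exists>C. \<forall>n. norm ((T ^^ n) (x + y)) \<le> C * exp (real n * (l + \<delta>))" by blast
  qed
  show "c *\<^sub>R x \<in> growth_space T l" if x: "x \<in> growth_space T l" for c x
    unfolding growth_space_def
  proof (safe)
    fix \<delta> :: real assume "\<delta> > 0"
    obtain C where C: "\<And>n. norm ((T ^^ n) x) \<le> C * exp (real n * (l + \<delta>))"
      using x \<open>\<delta> > 0\<close> unfolding growth_space_def by blast
    have "norm ((T ^^ n) (c *\<^sub>R x)) \<le> (\<bar>c\<bar> * C) * exp (real n * (l + \<delta>))" for n
      unfolding linear_scale[OF lin] norm_scaleR mult.assoc by (rule mult_left_mono[OF C]) simp
    then show "\<exists>C. \<forall>n. norm ((T ^^ n) (c *\<^sub>R x)) \<le> C * exp (real n * (l + \<delta>))" by blast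
  qed
qed

lemma growth_space_mono:
  assumes "l \<le> l'"
  shows "growth_space T l \<subseteq> growth_space T l'"
proof
  fix v assume v: "v \<in> growth_space T l"
  show "v \<in> growth_space T l'"
    unfolding growth_space_def
  proof safe
    fix \<delta> :: real assume "\<delta> > 0"
    then have "l' - l + \<delta> > 0" using assms by simp
    then have "\<exists>C. \<forall>n. norm ((T ^^ n) v) \<le> C * exp (real n * (l + (l' - l + \<delta>)))"
      using v unfolding growth_space_def by blast
    then show "\<exists>C. \<forall>n. norm ((T ^^ n) v) \<le> C * exp (real n * (l' + \<delta>))"
      by (simp add: algebra_simps)
  qed
qed

lemma growth_space_commuting_image:
  fixes T U :: "'a::euclidean_space \<Rightarrow> 'a"
  assumes "linear U" and comm: "\<And>x. U (T x) = T (U x)" and v: "v \<in> growth_space T l"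
  shows "U v \<in> growth_space T l"
  unfolding growth_space_def
proof safe
  fix \<delta> :: real assume "\<delta> > 0"
  then obtain C where C: "\<And>n. norm ((T ^^ n) v) \<le> C * exp (real n * (l + \<delta>))"
    using v unfolding growth_space_def by blast
  obtain K where K: "K > 0" "\<And>x. norm (U x) \<le> norm x * K"
    using bounded_linear.pos_bounded[OF linear_conv_bounded_linear[THEN iffD1, OF \<open>linear U\<close>]] by auto
  have pow: "(T ^^ n) (U v) = U ((T ^^ n) v)" for n by (induction n) (simp_all add: comm)
  have "norm ((T ^^ n) (U v)) \<le> (C * K) * exp (real n * (l + \<delta>))" for n
  proof -
    have "norm ((T ^^ n) (U v)) \<le> norm ((T ^^ n) v) * K" unfolding pow by (rule K(2))
    also have "\<dots> \<le> C * exp (real n * (l + \<delta>)) * K" using K(1) C by (intro mult_right_mono) auto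
    finally show ?thesis by (simp add: mult_ac)
  qed
  then show "\<exists>C. \<forall>n. norm ((T ^^ n) (U v)) \<le> C * exp (real n * (l + \<delta>))" by blast
qed

lemma independent_coefficients_bounded:
  fixes S :: "'a::euclidean_space set"
  assumes "independent S"
  shows "\<exists>K>0. \<forall>a. \<forall>b\<in>S. \<bar>a b\<bar> \<le> K * norm (\<Sum>b\<in>S. a b *\<^sub>R b)"
proof -
  have fin: "finite S" using assms by (rule independent_imp_finite)
  have "\<exists>K>0. \<forall>a. \<bar>a b\<bar> \<le> K * norm (\<Sum>b\<in>S. a b *\<^sub>R b)" if b: "b \<in> S" for b
  proof -
    obtain \<phi> :: "'a \<Rightarrow> real" where \<phi>: "linear \<phi>" "\<forall>x\<in>S. \<phi> x = (if x = b then 1 else 0)"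
      using linear_independent_extend[OF assms, of "\<lambda>x. if x = b then 1 else (0::real)"] by blast
    obtain K where K: "K > 0" "\<And>x. norm (\<phi> x) \<le> norm x * K"
      using bounded_linear.pos_bounded[OF linear_conv_bounded_linear[THEN iffD1, OF \<phi>(1)]] by auto
    have "\<phi> (\<Sum>b\<in>S. a b *\<^sub>R b) = (\<Sum>x\<in>S. a x * (if x = b then 1 else 0))" for a
      unfolding linear_sum[OF \<phi>(1)] using \<phi> by (intro sum.cong) (auto simp: linear_scale)
    then have "\<phi> (\<Sum>b\<in>S. a b *\<^sub>R b) = a b" for a
      using fin b by (simp add: if_distrib cong: if_cong)
    then show ?thesis using K by (metis mult.commute real_norm_def)
  qed
  then obtain K where K: "\<And>b. b \<in> S \<Longrightarrow> K b > 0"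
      "\<And>b a. b \<in> S \<Longrightarrow> \<bar>a b\<bar> \<le> K b * norm (\<Sum>b\<in>S. a b *\<^sub>R b)"
    by metis
  define K' where "K' = 1 + (\<Sum>b\<in>S. K b)"
  have "\<bar>a b\<bar> \<le> K' * norm (\<Sum>b\<in>S. a b *\<^sub>R b)" if b: "b \<in> S" for a b
  proof -
    have "K b \<le> (\<Sum>b\<in>S. K b)"
      using K(1) b fin by (intro member_le_sum) (auto intro: less_imp_le)
    then have "K b \<le> K'" by (simp add: K'_def)
    then show ?thesis using K(2)[OF b, of a] by (meson mult_right_mono norm_ge_zero order_trans)
  qed
  moreover have "K' > 0" unfolding K'_def
    using K(1) by (intro add_pos_nonneg sum_nonneg) (auto intro: less_imp_le)
  ultimately show ?thesis by blast
qed

text \<open>The constant can be chosen uniformly because a growth space has a finite basis.\<close>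

lemma growth_space_uniform_bound:
  fixes T :: "'a::euclidean_space \<Rightarrow> 'a"
  assumes T: "linear T" and "\<delta> > 0"
  obtains C where "C > 0"
    "\<And>v n. v \<in> growth_space T l \<Longrightarrow> norm ((T ^^ n) v) \<le> C * exp (real n * (l + \<delta>)) * norm v"
proof -
  obtain S where S: "S \<subseteq> growth_space T l" "independent S" "growth_space T l \<subseteq> span S"
    using basis_exists[of "growth_space T l"] by metis
  have fin: "finite S" using S(2) by (rule independent_imp_finite)
  obtain K where K: "K > 0" "\<And>a b. b \<in> S \<Longrightarrow> \<bar>a b\<bar> \<le> K * norm (\<Sum>b\<in>S. a b *\<^sub>R b)"
    using independent_coefficients_bounded[OF S(2)] by blast
  have "\<forall>b\<in>S. \<exists>C. \<forall>n. norm ((T ^^ n) b) \<le> C * exp (real n * (l + \<delta>))"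
    using S(1) \<open>\<delta> > 0\<close> unfolding growth_space_def by blast
  then obtain C where C: "\<And>b n. b \<in> S \<Longrightarrow> norm ((T ^^ n) b) \<le> C b * exp (real n * (l + \<delta>))"
    by metis
  define D where "D = 1 + K * (\<Sum>b\<in>S. \<bar>C b\<bar>)"
  show thesis
  proof (rule that)
    show "D > 0" using K(1) by (simp add: D_def sum_nonneg add_pos_nonneg)
    fix v n assume v: "v \<in> growth_space T l"
    then obtain a where a: "v = (\<Sum>b\<in>S. a b *\<^sub>R b)"
      using S(3) span_finite[OF fin] by auto
    have "norm ((T ^^ n) v) \<le> (\<Sum>b\<in>S. \<bar>a b\<bar> * norm ((T ^^ n) b))"
      unfolding a linear_sum[OF linear_funpow[OF T]] linear_scale[OF linear_funpow[OF T]]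
      by (rule order.trans[OF norm_sum]) simp
    also have "\<dots> \<le> (\<Sum>b\<in>S. (K * norm v) * (\<bar>C b\<bar> * exp (real n * (l + \<delta>))))"
    proof (intro sum_mono mult_mono)
      fix b assume b: "b \<in> S"
      show "\<bar>a b\<bar> \<le> K * norm v" using K(2)[OF b, of a] by (simp add: a)
      show "norm ((T ^^ n) b) \<le> \<bar>C b\<bar> * exp (real n * (l + \<delta>))"
        by (rule order.trans[OF C[OF b]]) (simp add: mult_right_mono)
    qed (use K(1) in auto)
    also have "\<dots> = (K * (\<Sum>b\<in>S. \<bar>C b\<bar>)) * (exp (real n * (l + \<delta>)) * norm v)"
      by (simp add: sum_distrib_left sum_distrib_right mult_ac)
    also have "\<dots> \<le> D * (exp (real n * (l + \<delta>)) * norm v)"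
      by (intro mult_right_mono) (auto simp: D_def)
    finally show "norm ((T ^^ n) v) \<le> D * exp (real n * (l + \<delta>)) * norm v" by (simp add: mult.assoc)
  qed
qed

lemma funpow_inverse:
  fixes P Q :: "'a \<Rightarrow> 'a"
  assumes "\<And>x. Q (P x) = x"
  shows "(Q ^^ n) ((P ^^ n) x) = x"
proof (induction n)
  case (Suc n)
  have "(Q ^^ Suc n) ((P ^^ Suc n) x) = (Q ^^ n) (Q (P ((P ^^ n) x)))"
    by (simp add: funpow_swap1[of Q])
  then show ?case using Suc by (simp add: assms)
qed simp

text \<open>A vector in both spaces grows forwards at rate at most \<open>l\<close>. Its iterates lie in the second space, where
  going back \<open>n\<close> steps multiplies the norm by little more than \<open>exp (- n * l')\<close>, uniformly. Since
  \<open>l < l'\<close>, going forwards and back again shrinks the vector by an arbitrarily small factor.\<close>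

lemma growth_spaces_disjoint:
  fixes P Q :: "'a::euclidean_space \<Rightarrow> 'a"
  assumes lin: "linear P" "linear Q" and inv: "\<And>x. Q (P x) = x" "\<And>x. P (Q x) = x"
    and "l < l'"
  shows "growth_space P l \<inter> growth_space Q (- l') \<subseteq> {0}"
proof safe
  fix v assume v: "v \<in> growth_space P l" "v \<in> growth_space Q (- l')"
  define \<delta> where "\<delta> = (l' - l) / 4"
  have \<delta>: "\<delta> > 0" using \<open>l < l'\<close> by (simp add: \<delta>_def)
  obtain C where C: "C > 0" "\<And>v n. v \<in> growth_space Q (- l') \<Longrightarrow>
      norm ((Q ^^ n) v) \<le> C * exp (real n * (- l' + \<delta>)) * norm v"
    using growth_space_uniform_bound[OF lin(2) \<delta>, of "- l'"] by blast
  obtain D where D: "\<And>n. norm ((P ^^ n) v) \<le> D * exp (real n * (l + \<delta>))"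
    using v(1) \<delta> unfolding growth_space_def by blast
  have inQ: "(P ^^ n) v \<in> growth_space Q (- l')" for n
    by (induction n) (auto simp: v(2) inv intro: growth_space_commuting_image[OF lin(1)])
  have bound: "norm v \<le> C * D * exp (- (2 * \<delta>)) ^ n" for n
  proof -
    have "norm v = norm ((Q ^^ n) ((P ^^ n) v))" by (simp add: funpow_inverse inv(1))
    also have "\<dots> \<le> C * exp (real n * (- l' + \<delta>)) * norm ((P ^^ n) v)" by (rule C(2)[OF inQ])
    also have "\<dots> \<le> C * exp (real n * (- l' + \<delta>)) * (D * exp (real n * (l + \<delta>)))"
      using C(1) D by (intro mult_left_mono) auto
    also have "\<dots> = C * D * exp (real n * (- l' + \<delta>) + real n * (l + \<delta>))"
      by (simp add: exp_add)
    also have "real n * (- l' + \<delta>) + real n * (l + \<delta>) = real n * (- (2 * \<delta>))"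
      by (simp add: \<delta>_def field_simps)
    finally show ?thesis by (simp only: exp_of_nat_mult)
  qed
  have "(\<lambda>n. C * D * exp (- (2 * \<delta>)) ^ n) \<longlonglongrightarrow> C * D * 0"
    using \<delta> by (intro tendsto_intros LIMSEQ_power_zero) simp
  then have "norm v \<le> C * D * 0" by (rule Lim_bounded2) (use bound in auto)
  then show "v = 0" by simp
qed

text \<open>Addition is injective on the product of the two subspaces, and an injective linear map on a finite
  dimensional space is bounded from below.\<close>

lemma complementary_summand_bounded:
  fixes V W :: "'a::euclidean_space set"
  assumes "subspace V" "subspace W" "V \<inter> W \<subseteq> {0}"
  obtains K where "K > 0" "\<And>v w. v \<in> V \<Longrightarrow> w \<in> W \<Longrightarrow> norm v \<le> K * norm (v + w) \<and> norm w \<le> K * norm (v + w)"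
proof -
  have sub: "subspace (V \<times> W)" using assms by (intro subspace_Times)
  have "\<exists>e>0. \<forall>x\<in>V \<times> W. e * norm x \<le> norm (fst x + snd x)"
  proof (rule injective_imp_isometric)
    show "closed (V \<times> W)" by (rule closed_subspace[OF sub])
    show "bounded_linear (\<lambda>x::'a \<times> 'a. fst x + snd x)" by (intro bounded_linear_intros)
    show "\<forall>x\<in>V \<times> W. fst x + snd x = 0 \<longrightarrow> x = 0"
    proof safe
      fix v w assume vw: "v \<in> V" "w \<in> W" "fst (v, w) + snd (v, w) = 0"
      then have "v = - w" by (simp add: eq_neg_iff_add_eq_0)
      then have "v \<in> V \<inter> W" using vw subspace_neg[OF assms(2)] by auto
      then show "(v, w) = 0" using assms(3) \<open>v = - w\<close> by (auto simp: zero_prod_def)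
    qed
  qed (rule sub)
  then obtain e where e: "e > 0" "\<And>v w. v \<in> V \<Longrightarrow> w \<in> W \<Longrightarrow> e * norm (v, w) \<le> norm (v + w)"
    by force
  show thesis
  proof (rule that[of "1 / e"])
    fix v w assume "v \<in> V" "w \<in> W"
    then have "norm (v, w) \<le> norm (v + w) / e" using e(2)[of v w] e(1) by (simp add: field_simps)
    then show "norm v \<le> 1 / e * norm (v + w) \<and> norm w \<le> 1 / e * norm (v + w)"
      using norm_fst_le[of v w] norm_snd_le[of w v] by simp
  qed (use e in simp)
qed

text \<open>For \<open>Q\<close> inverse to \<open>P\<close>, the vectors that grow at the exact rate \<open>l\<close> in both directions of time, and
  zero.\<close>

definition lyapunov_space :: "('a::real_normed_vector \<Rightarrow> 'a) \<Rightarrow> ('a \<Rightarrow> 'a) \<Rightarrow> real \<Rightarrow> 'a set" where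
  "lyapunov_space P Q l = growth_space P l \<inter> growth_space Q (- l)"

text \<open>Quantitative independence of the spaces \<open>lyapunov_space P Q l\<close>. The induction adds the
  smallest exponent \<open>b\<close> last: the sum of the other spaces lies in a backward growth space that meets
  the space of \<open>b\<close> only in zero.\<close>

lemma lyapunov_spaces_projection_bounded:
  fixes P Q :: "'a::euclidean_space \<Rightarrow> 'a"
  assumes lin: "linear P" "linear Q" and inv: "\<And>x. Q (P x) = x" "\<And>x. P (Q x) = x"
    and "finite L"
  shows "\<exists>K>0. \<forall>u. (\<forall>l\<in>L. u l \<in> lyapunov_space P Q l) \<longrightarrow>
    (\<forall>l\<in>L. norm (u l) \<le> K * norm (\<Sum>l\<in>L. u l))"
  using \<open>finite L\<close>
proof (induction L rule: finite_linorder_min_induct)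
  case empty
  then show ?case by (auto intro: exI[of _ 1])
next
  case (insert b A)
  obtain K where K: "K > 0" "\<And>u l. (\<forall>l\<in>A. u l \<in> lyapunov_space P Q l) \<Longrightarrow> l \<in> A \<Longrightarrow>
      norm (u l) \<le> K * norm (\<Sum>l\<in>A. u l)"
    using insert.IH by blast
  \<comment> \<open>A bound that separates \<open>b\<close> from the other exponents; any value above \<open>b\<close> will do when there are none.\<close>
  define l' where "l' = (if A = {} then b + 1 else Min A)"
  have l': "b < l'" "\<And>a. a \<in> A \<Longrightarrow> l' \<le> a" using insert.hyps by (auto simp: l'_def)
  obtain K' where K': "K' > 0" "\<And>v w. v \<in> growth_space P b \<Longrightarrow> w \<in> growth_space Q (- l') \<Longrightarrow>
      norm v \<le> K' * norm (v + w) \<and> norm w \<le> K' * norm (v + w)"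
    using complementary_summand_bounded[OF subspace_growth_space[OF lin(1)]
        subspace_growth_space[OF lin(2)] growth_spaces_disjoint[OF lin inv l'(1)]] by blast
  have "norm (u l) \<le> (K' + K * K') * norm (\<Sum>l\<in>insert b A. u l)"
    if u: "\<forall>l\<in>insert b A. u l \<in> lyapunov_space P Q l" and l: "l \<in> insert b A" for u l
  proof -
    let ?w = "\<Sum>l\<in>A. u l"
    have sum: "(\<Sum>l\<in>insert b A. u l) = u b + ?w" using insert.hyps by auto
    have "u a \<in> growth_space Q (- l')" if "a \<in> A" for a
      using u that l'(2)[OF that] growth_space_mono[of "- a" "- l'" Q]
      by (auto simp: lyapunov_space_def)
    then have "?w \<in> growth_space Q (- l')"
      by (intro subspace_sum subspace_growth_space lin) auto
    moreover have "u b \<in> growth_space P b" using u by (simp add: lyapunov_space_def)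
    ultimately have *: "norm (u b) \<le> K' * norm (u b + ?w)" "norm ?w \<le> K' * norm (u b + ?w)"
      using K'(2) by blast+
    have nonneg: "0 \<le> K' * norm (u b + ?w)" "0 \<le> K * (K' * norm (u b + ?w))" using K K' by auto
    show ?thesis
    proof (cases "l = b")
      case True
      then show ?thesis using *(1) nonneg unfolding sum by (simp add: algebra_simps)
    next
      case False
      then have "norm (u l) \<le> K * norm ?w" using l u K(2) by auto
      also have "\<dots> \<le> K * (K' * norm (u b + ?w))" using *(2) K(1) by (intro mult_left_mono) auto
      finally show ?thesis using nonneg unfolding sum by (simp add: algebra_simps)
    qed
  qed
  moreover have "K' + K * K' > 0" using K(1) K'(1) by (simp add: add_pos_pos)
  ultimately show ?case by blast
qed

text \<open>Decompose a vector as a sum of vectors \<open>w l\<close>. The backward bound on the space of \<open>l\<close> shows that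
  \<open>P ^^ n\<close> expands \<open>w l\<close> by nearly \<open>exp (n * l)\<close>, and the images of the summands are controlled
  by the image of the sum because the spaces are invariant and the projections to them are bounded.
  The pairs \<open>(l, b)\<close> index the vectors of the bases \<open>S l\<close>.\<close>

lemma lyapunov_space_coefficient_rate:
  fixes P Q :: "'a::euclidean_space \<Rightarrow> 'a"
  assumes lin: "linear P" "linear Q" and inv: "\<And>x. Q (P x) = x" "\<And>x. P (Q x) = x"
    and "finite L" and S: "\<And>l. l \<in> L \<Longrightarrow> S l \<subseteq> lyapunov_space P Q l \<and> independent (S l)"
    and \<delta>: "\<delta> > 0"
  shows "\<exists>C>0. \<forall>a. \<forall>n. \<forall>l\<in>L. \<forall>b\<in>S l. \<bar>a (l, b)\<bar> \<le> C * exp (- (real n * (l - \<delta>))) *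
    norm ((P ^^ n) (\<Sum>(l, b)\<in>Sigma L S. a (l, b) *\<^sub>R b))"
proof -
  note linP = linear_funpow[OF lin(1)]
  have fin: "finite (S l)" if "l \<in> L" for l using S[OF that] independent_imp_finite by blast
  obtain K where K: "K > 0" "\<And>u l. (\<forall>l\<in>L. u l \<in> lyapunov_space P Q l) \<Longrightarrow> l \<in> L \<Longrightarrow>
      norm (u l) \<le> K * norm (\<Sum>l\<in>L. u l)"
    using lyapunov_spaces_projection_bounded[OF lin inv \<open>finite L\<close>] by blast
  have sub: "subspace (lyapunov_space P Q l)" for l
    unfolding lyapunov_space_def by (intro subspace_inter subspace_growth_space lin)
  have invariant: "(P ^^ n) w \<in> lyapunov_space P Q l" if "w \<in> lyapunov_space P Q l" for w l n
  proof (induction n)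
    case (Suc n)
    then show ?case
      unfolding lyapunov_space_def
      by (auto simp: inv intro: growth_space_commuting_image[OF lin(1)])
  qed (simp add: that)
  have "\<exists>C>0. \<forall>a n. \<forall>b\<in>S l. \<bar>a (l, b)\<bar> \<le> C * exp (- (real n * (l - \<delta>))) *
      norm ((P ^^ n) (\<Sum>(l, b)\<in>Sigma L S. a (l, b) *\<^sub>R b))" if l: "l \<in> L" for l
  proof -
    obtain M where M: "M > 0" "\<And>a b. b \<in> S l \<Longrightarrow> \<bar>a b\<bar> \<le> M * norm (\<Sum>b\<in>S l. a b *\<^sub>R b)"
      using independent_coefficients_bounded[of "S l"] S[OF l] by blast
    obtain C where C: "C > 0" "\<And>v n. v \<in> growth_space Q (- l) \<Longrightarrow>
        norm ((Q ^^ n) v) \<le> C * exp (real n * (- l + \<delta>)) * norm v"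
      using growth_space_uniform_bound[OF lin(2) \<delta>, of "- l"] by blast
    have "\<bar>a (l, b)\<bar> \<le> (M * C * K) * exp (- (real n * (l - \<delta>))) *
        norm ((P ^^ n) (\<Sum>(l, b)\<in>Sigma L S. a (l, b) *\<^sub>R b))" if b: "b \<in> S l" for a n b
    proof -
      define w where "w l = (\<Sum>b\<in>S l. a (l, b) *\<^sub>R b)" for l
      have w: "w l \<in> lyapunov_space P Q l" if "l \<in> L" for l
        unfolding w_def using S[OF that]
        by (intro subspace_sum[OF sub] subspace_scale[OF sub]) auto
      have sum: "(\<Sum>(l, b)\<in>Sigma L S. a (l, b) *\<^sub>R b) = (\<Sum>l\<in>L. w l)"
        unfolding w_def using \<open>finite L\<close> fin by (subst sum.Sigma) auto
      have "\<bar>a (l, b)\<bar> \<le> M * norm (w l)" using M(2)[OF b, of "\<lambda>b. a (l, b)"] by (simp add: w_def)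
      also have "norm (w l) = norm ((Q ^^ n) ((P ^^ n) (w l)))"
        by (simp add: funpow_inverse inv(1))
      also have "\<dots> \<le> C * exp (real n * (- l + \<delta>)) * norm ((P ^^ n) (w l))"
        using invariant[OF w[OF l]] by (intro C(2)) (auto simp: lyapunov_space_def)
      also have "norm ((P ^^ n) (w l)) \<le> K * norm (\<Sum>l\<in>L. (P ^^ n) (w l))"
        using K(2)[of "\<lambda>l. (P ^^ n) (w l)" l] l invariant w by blast
      also have "(\<Sum>l\<in>L. (P ^^ n) (w l)) = (P ^^ n) (\<Sum>l\<in>L. w l)"
        by (rule linear_sum[OF linP, symmetric])
      finally show ?thesis
        using M(1) C(1) unfolding sum by (simp add: mult_ac right_diff_distrib)
    qed
    moreover have "M * C * K > 0" using M(1) C(1) K(1) by simp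
    ultimately show ?thesis by blast
  qed
  then have "\<forall>l\<in>L. \<exists>C>0. \<forall>a n. \<forall>b\<in>S l. \<bar>a (l, b)\<bar> \<le> C * exp (- (real n * (l - \<delta>))) *
      norm ((P ^^ n) (\<Sum>(l, b)\<in>Sigma L S. a (l, b) *\<^sub>R b))" by blast
  from bchoice[OF this] obtain C where C: "\<And>l. l \<in> L \<Longrightarrow> C l > 0" "\<And>l a n b. l \<in> L \<Longrightarrow> b \<in> S l \<Longrightarrow>
      \<bar>a (l, b)\<bar> \<le> C l * exp (- (real n * (l - \<delta>))) *
        norm ((P ^^ n) (\<Sum>(l, b)\<in>Sigma L S. a (l, b) *\<^sub>R b))"
    by blast
  define D where "D = 1 + (\<Sum>l\<in>L. C l)"
  have "\<bar>a (l, b)\<bar> \<le> D * exp (- (real n * (l - \<delta>))) *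
      norm ((P ^^ n) (\<Sum>(l, b)\<in>Sigma L S. a (l, b) *\<^sub>R b))" if l: "l \<in> L" "b \<in> S l" for a n l b
  proof -
    have "C l \<le> (\<Sum>l\<in>L. C l)"
      using C(1) l(1) \<open>finite L\<close> by (intro member_le_sum) (auto intro: less_imp_le)
    then have "C l \<le> D" by (simp add: D_def)
    then show ?thesis
      by (intro order.trans[OF C(2)[OF l, of a n]] mult_right_mono) auto
  qed
  moreover have "D > 0" unfolding D_def
    using C(1) by (intro add_pos_nonneg sum_nonneg) (auto intro: less_imp_le)
  ultimately show ?thesis by blast
qed

text \<open>The counting lemma for bases of the spaces, with rates \<open>l - \<delta>\<close>, and \<open>\<delta>\<close> tending to zero.\<close>

lemma entropy_ge_sum_lyapunov_spaces:
  fixes g :: "'n::finite torus \<Rightarrow> 'n torus"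
  assumes g: "\<And>x. g (torus_of x) = torus_of (B *v x + c)"
    and inv: "Q ** B = mat 1" "B ** Q = mat 1" and "finite L"
  shows "ereal (\<Sum>l\<in>L. real (dim (lyapunov_space ((*v) B) ((*v) Q) l)) * l) \<le> topological_entropy g"
proof -
  let ?F = "lyapunov_space ((*v) B) ((*v) Q)"
  have inv': "Q *v (B *v x) = x" "B *v (Q *v x) = x" for x
    by (simp_all add: matrix_vector_mul_assoc inv)
  have "\<exists>S. S \<subseteq> ?F l \<and> independent S \<and> card S = dim (?F l)" for l
    using basis_exists[of "?F l"] by metis
  then obtain S where S: "\<And>l. S l \<subseteq> ?F l" "\<And>l. independent (S l)" "\<And>l. card (S l) = dim (?F l)"
    by metis
  have fin: "finite (Sigma L S)"
    using \<open>finite L\<close> S(2) independent_imp_finite by blast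
  define d where "d = (\<Sum>l\<in>L. real (card (S l)))"
  have "d \<ge> 0" by (simp add: d_def sum_nonneg)
  show ?thesis
  proof (rule ereal_le_epsilon2)
    fix e :: real assume "e > 0"
    define \<delta> where "\<delta> = e / (d + 1)"
    have \<delta>: "\<delta> > 0" using \<open>e > 0\<close> \<open>d \<ge> 0\<close> by (simp add: \<delta>_def)
    obtain C where C: "C > 0" "\<And>a n l b. l \<in> L \<Longrightarrow> b \<in> S l \<Longrightarrow>
        \<bar>a (l, b)\<bar> \<le> C * exp (- (real n * (l - \<delta>))) *
          norm ((((*v) B) ^^ n) (\<Sum>(l, b)\<in>Sigma L S. a (l, b) *\<^sub>R b))"
      using lyapunov_space_coefficient_rate[of "(*v) B" "(*v) Q" L S \<delta>] inv' \<open>finite L\<close> S(1,2) \<delta>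
      by auto
    have "ereal (\<Sum>i\<in>Sigma L S. fst i - \<delta>) \<le> topological_entropy g"
    proof (rule entropy_ge_sum_expansion_rates[where v = snd, OF g fin C(1)])
      fix a :: "real \<times> (real ^ 'n) \<Rightarrow> real" and i n assume "i \<in> Sigma L S"
      then show "\<bar>a i\<bar> \<le> C * exp (- (real n * (fst i - \<delta>))) *
          norm ((((*v) B) ^^ n) (\<Sum>i\<in>Sigma L S. a i *\<^sub>R snd i))"
        using C(2)[of "fst i" "snd i" a n] by (auto simp: case_prod_unfold)
    qed
    moreover have "(\<Sum>i\<in>Sigma L S. fst i - \<delta>) = (\<Sum>l\<in>L. \<Sum>b\<in>S l. l - \<delta>)"
      using \<open>finite L\<close> S(2) independent_imp_finite
      by (subst sum.Sigma) (auto simp: case_prod_unfold)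
    moreover have "\<dots> = (\<Sum>l\<in>L. real (dim (?F l)) * l) - d * \<delta>"
      by (simp add: S(3) d_def right_diff_distrib sum_subtractf sum_distrib_right)
    moreover have "d * \<delta> \<le> e" using \<open>e > 0\<close> \<open>d \<ge> 0\<close> by (simp add: \<delta>_def field_simps)
    ultimately have "ereal ((\<Sum>l\<in>L. real (dim (?F l)) * l) - e) \<le> topological_entropy g"
      by (auto elim!: order.trans[rotated])
    from add_right_mono[OF this, of "ereal e"]
    show "ereal (\<Sum>l\<in>L. real (dim (?F l)) * l) \<le> topological_entropy g + ereal e"
      by simp
  qed
qed

section \<open>Lyapunov exponents of affine maps\<close>

lemma entropy_nonneg:
  fixes g :: "'n::finite torus \<Rightarrow> 'n torus"
  shows "0 \<le> topological_entropy g"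
proof -
  have "ereal 0 \<le> topological_entropy g"
    by (rule entropy_ge_of_card_separated[of 1 1])
      (auto simp: separated_def intro!: exI[of _ "{torus_of 0}"])
  then show ?thesis by (simp add: zero_ereal_def)
qed

lemma torus_deriv_affine:
  assumes "\<And>x. h (torus_of x) = torus_of (D x + d)" and "linear D"
  shows "torus_deriv h p = D"
proof -
  obtain x where x: "torus_of x = p" using torus_of_surj by blast
  have "((\<lambda>x. D x + d) has_derivative D) (at x)"
    using linear_imp_has_derivative[OF \<open>linear D\<close>] by (auto intro!: derivative_eq_intros)
  then have "has_torus_derivative h D p"
    unfolding has_torus_derivative_def using assms(1) x
    by (intro exI[of _ x] exI[of _ "\<lambda>x. D x + d"]) simp
  then show ?thesis
    unfolding torus_deriv_def using has_torus_derivative_unique by blast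
qed

lemma torus_deriv_funpow:
  fixes g :: "'n::finite torus \<Rightarrow> 'n torus"
  assumes "\<And>x. g (torus_of x) = torus_of (B *v x + c)"
  shows "torus_deriv (g ^^ n) p = ((*v) B) ^^ n"
proof -
  obtain d where "\<And>x. (g ^^ n) (torus_of x) = torus_of ((((*v) B) ^^ n) x + d)"
    using affine_torus_map_funpow[of g B c n] assms by blast
  then show ?thesis by (rule torus_deriv_affine) (rule linear_funpow_matrix)
qed

text \<open>From some time on the norm is below \<open>exp (n * (l + \<delta>))\<close>, and the finitely many earlier times are
  absorbed in the constant.\<close>

lemma exponential_rate_imp_growth_space:
  assumes lim: "(\<lambda>n. ln (norm ((T ^^ n) v)) / real n) \<longlonglongrightarrow> l"
  shows "v \<in> growth_space T l"
  unfolding growth_space_def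
proof safe
  fix \<delta> :: real assume "\<delta> > 0"
  then have "\<forall>\<^sub>F n in sequentially. ln (norm ((T ^^ n) v)) / real n < l + \<delta>"
    using order_tendstoD(2)[OF lim] by simp
  then obtain N where N: "\<And>n. n \<ge> N \<Longrightarrow> ln (norm ((T ^^ n) v)) / real n < l + \<delta>"
    by (auto simp: eventually_sequentially)
  define C where "C = 1 + (\<Sum>n\<le>N. norm ((T ^^ n) v) / exp (real n * (l + \<delta>)))"
  have C1: "C \<ge> 1" by (simp add: C_def sum_nonneg)
  have "norm ((T ^^ n) v) \<le> C * exp (real n * (l + \<delta>))" for n
  proof (cases "n \<le> N")
    case True
    then have "norm ((T ^^ n) v) / exp (real n * (l + \<delta>))
        \<le> (\<Sum>n\<le>N. norm ((T ^^ n) v) / exp (real n * (l + \<delta>)))"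
      by (intro member_le_sum) auto
    then have "norm ((T ^^ n) v) / exp (real n * (l + \<delta>)) \<le> C" by (simp add: C_def)
    then show ?thesis by (simp add: divide_le_eq)
  next
    case False
    have "norm ((T ^^ n) v) \<le> exp (real n * (l + \<delta>))"
    proof (cases "norm ((T ^^ n) v) = 0")
      case nz: False
      have "ln (norm ((T ^^ n) v)) < real n * (l + \<delta>)"
        using N[of n] False by (simp add: divide_less_eq mult.commute)
      then have "exp (ln (norm ((T ^^ n) v))) < exp (real n * (l + \<delta>))" by simp
      moreover have "exp (ln (norm ((T ^^ n) v))) = norm ((T ^^ n) v)" using nz by simp
      ultimately show ?thesis by linarith
    qed simp
    also have "\<dots> \<le> C * exp (real n * (l + \<delta>))" using C1 by simp
    finally show ?thesis .
  qed
  then show "\<exists>C. \<forall>n. norm ((T ^^ n) v) \<le> C * exp (real n * (l + \<delta>))" by blast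
qed

text \<open>Oseledets spaces are contained in the spaces \<open>lyapunov_space\<close>, whose dimensions therefore bound the
  multiplicities. If there were infinitely many exponents, the sum would be zero by convention.\<close>

lemma entropy_ge_sum_pos_lyapunov:
  fixes g :: "'n::finite torus \<Rightarrow> 'n torus"
  assumes g: "\<And>x. g (torus_of x) = torus_of (B *v x + c)"
    and inv_g: "\<And>x. inv g (torus_of x) = torus_of (Q *v x + d)"
    and inv: "Q ** B = mat 1" "B ** Q = mat 1"
  shows "ereal (sum_pos_lyapunov g p) \<le> topological_entropy g"
proof -
  let ?F = "lyapunov_space ((*v) B) ((*v) Q)"
  let ?L = "lyapunov_exponents g p"
  have "oseledets_space g p l \<subseteq> ?F l" for l
  proof
    fix v assume v: "v \<in> oseledets_space g p l"
    have "0 \<in> ?F l"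
      unfolding lyapunov_space_def by (intro IntI subspace_0 subspace_growth_space) simp_all
    then show "v \<in> ?F l"
      using v unfolding oseledets_space_def torus_deriv_funpow[OF g] torus_deriv_funpow[OF inv_g]
      by (auto simp: lyapunov_space_def intro: exponential_rate_imp_growth_space)
  qed
  then have dim: "dim (oseledets_space g p l) \<le> dim (?F l)" for l by (rule dim_subset)
  show ?thesis
  proof (cases "finite ?L")
    case True
    define L where "L = {l \<in> ?L. l > 0}"
    have "sum_pos_lyapunov g p = (\<Sum>l\<in>L. real (dim (oseledets_space g p l)) * max l 0)"
      unfolding sum_pos_lyapunov_def L_def using True by (intro sum.mono_neutral_right) auto
    also have "\<dots> \<le> (\<Sum>l\<in>L. real (dim (?F l)) * l)"
      using dim by (intro sum_mono) (auto simp: L_def)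
    finally have "ereal (sum_pos_lyapunov g p) \<le> ereal (\<Sum>l\<in>L. real (dim (?F l)) * l)" by simp
    also have "\<dots> \<le> topological_entropy g"
      using True by (intro entropy_ge_sum_lyapunov_spaces[OF g inv]) (auto simp: L_def)
    finally show ?thesis .
  next
    case False
    then show ?thesis using entropy_nonneg[of g] by (simp add: sum_pos_lyapunov_def zero_ereal_def)
  qed
qed

lemma sum_pos_lyapunov_affine_const:
  fixes g :: "'n::finite torus \<Rightarrow> 'n torus"
  assumes g: "\<And>x. g (torus_of x) = torus_of (B *v x + c)"
    and inv_g: "\<And>x. inv g (torus_of x) = torus_of (Q *v x + d)"
  shows "sum_pos_lyapunov g p = sum_pos_lyapunov g q"
  unfolding sum_pos_lyapunov_def lyapunov_exponents_def oseledets_space_def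
    torus_deriv_funpow[OF g] torus_deriv_funpow[OF inv_g] by (rule refl)

section \<open>Partially hyperbolic affine maps\<close>

text \<open>The norm of the inverse restricted to the unstable subspace bounds \<open>norm u\<close> by \<open>C * \<rho> ^ n\<close> times the
  length of the image of \<open>u\<close>, for an unstable vector \<open>u\<close>. This is the hypothesis of the counting lemma for
  the line spanned by \<open>u\<close>, with rate \<open>- ln \<rho>\<close>.\<close>

lemma entropy_pos_of_partially_hyperbolic:
  fixes g :: "'n::finite torus \<Rightarrow> 'n torus"
  assumes g: "\<And>x. g (torus_of x) = torus_of (B *v x + c)"
    and inv: "Q ** B = mat 1" "B ** Q = mat 1" and ph: "partially_hyperbolic g"
  shows "topological_entropy g > 0"
proof -
  let ?P = "(*v) B" and ?Q = "(*v) Q"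
  have inv': "Q *v (B *v x) = x" "B *v (Q *v x) = x" for x
    by (simp_all add: matrix_vector_mul_assoc inv)
  from ph obtain Eu Ec :: "'n torus \<Rightarrow> (real ^ 'n) set" where
      split: "\<forall>p. subspace (Eu p) \<and> subspace (Ec p) \<and>
             Eu p \<inter> Ec p = {0} \<and> {u + v |u v. u \<in> Eu p \<and> v \<in> Ec p} = UNIV \<and>
             torus_deriv g p ` Eu p = Eu (g p) \<and> torus_deriv g p ` Ec p = Ec (g p) \<and>
             Eu p \<noteq> {0}"
      and bounds: "\<exists>C>0. \<exists>\<rho>. 0 < \<rho> \<and> \<rho> < 1 \<and>
           (\<forall>p. \<forall>n\<ge>1.
              (let Dn = torus_deriv (g ^^ n) p;
                   inv_norm = onorm_on (Eu ((g ^^ n) p)) (inv_into (Eu p) Dn)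
               in inv_norm \<le> C * \<rho> ^ n \<and> inv_norm * onorm_on (Ec p) Dn \<le> C * \<rho> ^ n))"
    unfolding partially_hyperbolic_def by blast
  from bounds obtain C \<rho> where C: "C > 0" "0 < \<rho>" "\<rho> < 1"
      and contr: "\<And>p n. n \<ge> 1 \<Longrightarrow>
        onorm_on (Eu ((g ^^ n) p)) (inv_into (Eu p) (torus_deriv (g ^^ n) p)) \<le> C * \<rho> ^ n"
    unfolding Let_def by blast
  define p :: "'n torus" where "p = torus_of 0"
  obtain u where u: "u \<in> Eu p" "u \<noteq> 0"
  proof -
    have "Eu p \<noteq> {0}" "subspace (Eu p)" using split by simp_all
    moreover from this(2) have "0 \<in> Eu p" by (rule subspace_0)
    ultimately have "\<exists>u. u \<in> Eu p \<and> u \<noteq> 0" by blast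
    then show thesis using that by blast
  qed
  have deriv: "torus_deriv g q = ?P" for q using torus_deriv_funpow[OF g, of 1] by simp
  have Eu_step: "?P ` Eu q = Eu (g q)" for q using split by (simp add: deriv)
  have Eu_iter: "(?P ^^ n) ` Eu p = Eu ((g ^^ n) p)" for n
  proof (induction n)
    case (Suc n)
    have "(?P ^^ Suc n) ` Eu p = ?P ` ((?P ^^ n) ` Eu p)" by (simp add: image_image)
    then show ?case by (simp add: Suc Eu_step)
  qed simp
  then have iter_in: "(?P ^^ n) u \<in> Eu ((g ^^ n) p)" for n using u(1) by blast
  have Q_iter: "(?Q ^^ n) ((?P ^^ n) x) = x" for n x by (rule funpow_inverse) (rule inv')
  have expand: "norm u \<le> C * \<rho> ^ n * norm ((?P ^^ n) u)" if n: "n \<ge> 1" for n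
  proof -
    let ?E = "Eu ((g ^^ n) p)" and ?I = "inv_into (Eu p) (?P ^^ n)"
    have I: "?I w = (?Q ^^ n) w" if "w \<in> ?E" for w
    proof -
      obtain y where y: "y \<in> Eu p" "w = (?P ^^ n) y" using \<open>w \<in> ?E\<close> Eu_iter by blast
      have "inj_on (?P ^^ n) (Eu p)" using Q_iter by (metis inj_onI)
      then show ?thesis using y Q_iter by simp
    qed
    obtain K where K: "\<And>x. norm ((?Q ^^ n) x) \<le> norm x * K" "K > 0"
      using bounded_linear.pos_bounded[OF linear_conv_bounded_linear[THEN iffD1, OF linear_funpow_matrix[of n Q]]]
      by metis
    \<comment> \<open>Without an upper bound the supremum in the norm would carry no information.\<close>
    have bdd: "bdd_above ((\<lambda>w. norm (?I w) / norm w) ` ?E)"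
    proof (rule bdd_aboveI2)
      fix w assume "w \<in> ?E"
      then show "norm (?I w) / norm w \<le> K"
        using K(1)[of w] K(2) by (cases "w = 0") (auto simp: I divide_le_eq mult.commute)
    qed
    have "(?P ^^ n) u \<noteq> 0"
      using Q_iter[of n u] u(2) linear_0[OF linear_funpow_matrix[of n Q]] by metis
    moreover have "norm (?I ((?P ^^ n) u)) / norm ((?P ^^ n) u) \<le> C * \<rho> ^ n"
      using cSUP_upper[OF iter_in bdd] contr[OF n, of p]
      unfolding onorm_on_def torus_deriv_funpow[OF g] by (rule order.trans)
    ultimately show ?thesis by (simp add: I[OF iter_in] Q_iter divide_le_eq)
  qed
  define D where "D = (C + 1) / norm u"
  \<comment> \<open>The estimate on the splitting starts at \<open>n = 1\<close>; the constant \<open>C + 1\<close> makes it valid at \<open>n = 0\<close>.\<close>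
  have rate: "\<bar>a\<bar> \<le> D * \<rho> ^ n * norm ((?P ^^ n) (a *\<^sub>R u))" for a n
  proof -
    have "norm u \<le> (C + 1) * \<rho> ^ n * norm ((?P ^^ n) u)"
    proof (cases "n = 0")
      case False
      have "C * \<rho> ^ n * norm ((?P ^^ n) u) \<le> (C + 1) * \<rho> ^ n * norm ((?P ^^ n) u)"
        using C(2) by (intro mult_right_mono) auto
      then show ?thesis using expand[of n] False by simp
    qed (use C in \<open>simp add: distrib_right\<close>)
    then have "\<bar>a\<bar> * norm u \<le> \<bar>a\<bar> * ((C + 1) * \<rho> ^ n * norm ((?P ^^ n) u))"
      by (intro mult_left_mono) auto
    then show ?thesis
      using u(2) by (simp add: D_def linear_scale[OF linear_funpow_matrix] field_simps)
  qed
  have exp_\<rho>: "exp (- (real n * - ln \<rho>)) = \<rho> ^ n" for n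
    using C(2) by (simp add: exp_of_nat_mult)
  have "ereal (\<Sum>i\<in>{()}. - ln \<rho>) \<le> topological_entropy g"
  proof (rule entropy_ge_sum_expansion_rates[where v = "\<lambda>_. u", OF g])
    show "D > 0" using C(1) u(2) by (simp add: D_def)
    show "\<bar>a i\<bar> \<le> D * exp (- (real n * - ln \<rho>)) * norm ((?P ^^ n) (\<Sum>i\<in>{()}. a i *\<^sub>R u))"
      for a :: "unit \<Rightarrow> real" and i n
      unfolding exp_\<rho> using rate[of "a i" n] by simp
  qed simp
  moreover have "0 < ereal (\<Sum>i\<in>{()}. - ln \<rho>)" using C by simp
  ultimately show ?thesis using less_le_trans by blast
qed

section \<open>The centralizer of a linear Anosov diffeomorphism\<close>

theorem corollary6:
  fixes f :: "'n::finite torus \<Rightarrow> 'n torus"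
  assumes "linear_anosov f"
  shows "\<forall>g \<in> C2_centralizer f.
           preserves_measure torus_leb g \<and>
           topological_entropy g \<ge>
             enn2ereal (\<integral>\<^sup>+ p. ennreal (sum_pos_lyapunov g p) \<partial>torus_leb) \<and>
           (partially_hyperbolic g \<longrightarrow> topological_entropy g > 0)"
proof
  fix g assume "g \<in> C2_centralizer f"
  then have bij: "bij g" and C2: "torus_C2 g" "torus_C2 (inv g)" and comm: "g \<circ> f = f \<circ> g"
    by (auto simp: C2_centralizer_def C2_diffeo_def)
  have cont: "continuous_on UNIV g" "continuous_on UNIV (inv g)"
    using C2 by (auto intro: torus_C2_imp_continuous)
  have g_inv: "g (inv g p) = p" "inv g (g p) = p" for p
    using bij by (simp_all add: bij_is_surj surj_f_inv_f bij_is_inj)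
  have comm': "inv g \<circ> f = f \<circ> inv g"
  proof
    fix p
    have "g (f (inv g p)) = f p" using fun_cong[OF comm, of "inv g p"] by (simp add: g_inv)
    then show "(inv g \<circ> f) p = (f \<circ> inv g) p" by (metis comp_apply g_inv(2))
  qed
  obtain B c where B: "\<And>x. g (torus_of x) = torus_of (B *v x + c)"
    using commuting_with_anosov_is_affine[OF assms cont(1) comm] by metis
  obtain Q d where Q: "\<And>x. inv g (torus_of x) = torus_of (Q *v x + d)"
    using commuting_with_anosov_is_affine[OF assms cont(2) comm'] by metis
  have BQ: "B ** Q = mat 1" by (rule affine_diffeo_matrices_inverse[OF B Q g_inv(1)])
  have QB: "Q ** B = mat 1" by (rule affine_diffeo_matrices_inverse[OF Q B g_inv(2)])
  have sets: "sets torus_leb = sets borel" "space torus_leb = UNIV" by (simp_all add: torus_leb_def)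
  have gm: "g -` U \<in> sets borel" if "U \<in> sets borel" for U
    using measurable_sets[OF borel_measurable_continuous_onI[OF cont(1)] that] by simp
  have leb: "emeasure torus_leb (g -` U) = emeasure torus_leb U" if "U \<in> sets borel" for U
    using torus_leb_vimage_affine[of g B c Q] B BQ that gm by blast
  have meas: "g \<in> measurable torus_leb torus_leb"
    using borel_measurable_continuous_onI[OF cont(1)] by (simp add: measurable_cong_sets[OF sets(1) sets(1)])
  have "distr torus_leb torus_leb g = torus_leb"
  proof (rule measure_eqI)
    fix U assume "U \<in> sets (distr torus_leb torus_leb g)"
    then show "emeasure (distr torus_leb torus_leb g) U = emeasure torus_leb U"
      using meas leb by (subst emeasure_distr) (auto simp: sets)
  qed simp
  with meas have pres: "preserves_measure torus_leb g" by (simp add: preserves_measure_def)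
  define s where "s = sum_pos_lyapunov g (torus_of 0)"
  have const: "sum_pos_lyapunov g p = s" for p
    unfolding s_def by (rule sum_pos_lyapunov_affine_const[OF B Q])
  have "s \<ge> 0" unfolding s_def sum_pos_lyapunov_def by (intro sum_nonneg) auto
  then have "enn2ereal (\<integral>\<^sup>+ p. ennreal (sum_pos_lyapunov g p) \<partial>torus_leb) = ereal s"
    unfolding const by (simp add: emeasure_space_torus_leb)
  also have "\<dots> \<le> topological_entropy g"
    unfolding s_def by (rule entropy_ge_sum_pos_lyapunov[OF B Q QB BQ])
  finally show "preserves_measure torus_leb g \<and>
      topological_entropy g \<ge> enn2ereal (\<integral>\<^sup>+ p. ennreal (sum_pos_lyapunov g p) \<partial>torus_leb) \<and>
      (partially_hyperbolic g \<longrightarrow> topological_entropy g > 0)"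
    using pres entropy_pos_of_partially_hyperbolic[OF B QB BQ] by blast
qed

end
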